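(* Suppose that $0<\alpha<n$, $1<q_1\le p_1=n/\alpha$, $1<q_2\le p_2<q_2 n/\alpha$ and $\frac1{q_1}+\frac1{q_2}<1$. Then there exists a constant $C>0$ such that $$\|B_\alpha(f,g)\|_{\mathcal{M}^{p_2}_{q_2}}\le C\,\|f\|_{\mathcal{M}^{p_1}_{q_1}}\|g\|_{\mathcal{M}^{p_2}_{q_2}}$$ holds for all positive measurable functions $f$ and $g$.
   Context: For $0<\alpha<n$ the bilinear fractional integral operator is $B_\alpha(f,g)(x)=\int_{\mathbb{R}^n}\frac{f(x-y)g(x+y)}{|y|^{n-\alpha}}\,dy$. $\mathscr{D}$ denotes the set of dyadic cubes $2^k(m+[0,1)^n)$, $k\in\mathbb{Z}$, $m\in\mathbb{Z}^n$, and $\fint_Q h=\frac1{|Q|}\int_Q h$. For $0<q\le p<\infty$ the Morrey (quasi-)norm is $\|f\|_{\mathcal{M}^p_q}=\sup_{Q\in\mathscr{D}}|Q|^{1/p}\left(\fint_Q|f(x)|^q\,dx\right)^{1/q}$. *)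

theory Defs
  imports "HOL-Analysis.Analysis"
begin

text \<open>Real powers of extended nonnegative reals (exponent r > 0 intended):
  \<infinity> powr r = \<infinity>, otherwise the usual real power.\<close>
definition enn_powr :: "ennreal \<Rightarrow> real \<Rightarrow> ennreal" where
  "enn_powr x r = (if x = \<infinity> then \<infinity> else ennreal (enn2real x powr r))"

definition dyadic_cube :: "int \<Rightarrow> ('n::finite \<Rightarrow> int) \<Rightarrow> (real^'n) set" where
  "dyadic_cube k m = {x. \<forall>i. 2 powr k * of_int (m i) \<le> x $ i \<and> x $ i < 2 powr k * (of_int (m i) + 1)}"

definition dyadic_cubes :: "(real^'n::finite) set set" where
  "dyadic_cubes = {Q. \<exists>k m. Q = dyadic_cube k m}"

definition morrey_norm :: "real \<Rightarrow> real \<Rightarrow> (real^'n::finite \<Rightarrow> ennreal) \<Rightarrow> ennreal" where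
  "morrey_norm p q h = (SUP Q\<in>dyadic_cubes.
      ennreal (measure lebesgue Q powr (1/p)) *
      enn_powr (ennreal (1 / measure lebesgue Q) * (\<integral>\<^sup>+ x\<in>Q. enn_powr (h x) q \<partial>lebesgue)) (1/q))"

definition bilinear_frac_int :: "real \<Rightarrow> (real^'n::finite \<Rightarrow> real) \<Rightarrow> (real^'n \<Rightarrow> real) \<Rightarrow> real^'n \<Rightarrow> ennreal" where
  "bilinear_frac_int \<alpha> f g x = (\<integral>\<^sup>+ y. ennreal (f (x - y) * g (x + y) / norm y powr (real CARD('n) - \<alpha>)) \<partial>lebesgue)"

end

theory Submission
  imports Defs
begin

text \<open>
  Write \<open>b = q1\<close>, \<open>q = q2\<close> and let \<open>c\<close> be the exponent conjugate to \<open>b\<close>, so that \<open>c < q\<close>. Splitting the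
  kernel into annuli \<open>|y| ~ 2^k\<close> and applying Hoelder on dyadic cubes \<open>R\<close> of side \<open>2^k\<close>, the operator is
  dominated pointwise by the sum over \<open>R\<close> containing \<open>x\<close> of \<open>|R|^(\<alpha>/n) <f^b>^(1/b) <g^c>^(1/c)\<close>, the averages
  being over neighbours of \<open>R\<close>. On a fixed cube \<open>Q\<close>, the cubes larger than \<open>Q\<close> contribute a convergent geometric
  series by the two Morrey bounds. For the cubes inside \<open>Q\<close>, the weights \<open>|R|^(1 + \<alpha>/n) <f^b>^(1/b)\<close> satisfy a
  Carleson packing condition, because \<open>f\<close> has Morrey exponent \<open>n/\<alpha>\<close>; the Carleson embedding theorem, applied to
  \<open>g^c\<close> with exponent \<open>q/c > 1\<close> and to a dual function with exponent \<open>q/(q-1)\<close>, bounds this part in \<open>L^q(Q)\<close> by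
  the \<open>L^q\<close> norm of \<open>g\<close> near \<open>Q\<close>.
\<close>

section \<open>Dyadic trees and the Carleson embedding\<close>

text \<open>The condition 1/q1 + 1/q2 < 1 is exactly \<open>c < q\<close>, which the embedding
  theorem for \<open>g^c\<close> needs. The geometric obstacle is that \<open>x - y\<close> and
  \<open>x + y\<close> lie in cubes next to the cube \<open>R\<close> of \<open>x\<close>, in
  general two different ones, so the averages of \<open>f\<close> and \<open>g\<close> do not sit on
  \<open>R\<close> and may leave the tree below \<open>Q\<close>. Neighbours are recorded as integer
  shifts of the index; re-indexing by the cube of \<open>g\<close> leaves one relative shift for
  \<open>f\<close>, of size at most 2, and cubes outside \<open>Q\<close> are collected in the trees
  of the neighbours of \<open>Q\<close>. Moreover, induction and absorption ask for finite
  quantities, so all trees are cut after \<open>N\<close> generations, with bounds independent of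
  \<open>N\<close>; monotone convergence then removes the cut. Cubes are coded by a generation
  \<open>k\<close> and an index \<open>m\<close>, ancestors being integer quotients by powers of 2,
  so that the embedding theorem concerns real functions on a tree and needs no measure theory.
  Scaling both functions to Morrey norm at most 1 keeps the constant independent of them.\<close>

definition dyadic_desc :: "nat \<Rightarrow> ('n \<Rightarrow> int) \<Rightarrow> ('n \<Rightarrow> int) set" where
  "dyadic_desc j m = {m'. \<forall>i. m' i div 2 ^ j = m i}"

definition tree_sum :: "nat \<Rightarrow> (int \<Rightarrow> ('n \<Rightarrow> int) \<Rightarrow> real) \<Rightarrow> int \<Rightarrow> ('n \<Rightarrow> int) \<Rightarrow> real" where
  "tree_sum N F k m = (\<Sum>j<N. \<Sum>m'\<in>dyadic_desc j m. F (k - int j) m')"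

lemma div_eq_iff_int: 
  fixes a b c :: int
  assumes b: "0 < b"
  shows "a div b = c \<longleftrightarrow> b * c \<le> a \<and> a < b * (c + 1)"
proof
  assume "a div b = c"
  then have "a = b * c + a mod b" using mult_div_mod_eq[of b a] by simp
  with pos_mod_bound[OF b, of a] pos_mod_sign[OF b, of a] show "b * c \<le> a \<and> a < b * (c + 1)"
    unfolding distrib_left mult_1_right by linarith
next
  assume "b * c \<le> a \<and> a < b * (c + 1)"
  with b show "a div b = c"
    by (intro int_div_pos_eq[of a b c "a - b * c"]) (auto simp: algebra_simps)
qed

lemma dyadic_desc_PiE:
  "dyadic_desc j m = (\<Pi>\<^sub>E i\<in>UNIV. {2 ^ j * m i ..< 2 ^ j * (m i + 1)})"
  by (auto simp: dyadic_desc_def PiE_def Pi_def div_eq_iff_int)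

lemma finite_dyadic_desc [simp]: "finite (dyadic_desc j (m :: 'n::finite \<Rightarrow> int))"
  by (simp add: dyadic_desc_PiE finite_PiE)

lemma card_dyadic_desc: "card (dyadic_desc j (m :: 'n::finite \<Rightarrow> int)) = 2 ^ (j * CARD('n))"
  by (simp add: dyadic_desc_PiE card_PiE algebra_simps nat_power_eq power_mult)

lemma dyadic_desc_nonempty [simp]: "dyadic_desc j (m :: 'n::finite \<Rightarrow> int) \<noteq> {}"
  using card_dyadic_desc[of j m] by auto

lemma dyadic_desc_0 [simp]: "dyadic_desc 0 m = {m}"
  by (auto simp: dyadic_desc_def)

lemma dyadic_desc_disjoint: "c \<noteq> c' \<Longrightarrow> dyadic_desc j c \<inter> dyadic_desc j c' = {}"
  by (auto simp: dyadic_desc_def fun_eq_iff)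

lemma sum_dyadic_desc_Suc:
  fixes m :: "'n::finite \<Rightarrow> int"
  shows "(\<Sum>m'\<in>dyadic_desc (Suc j) m. F m') = (\<Sum>c\<in>dyadic_desc 1 m. \<Sum>m'\<in>dyadic_desc j c. F m')"
proof -
  have "m' \<in> dyadic_desc (Suc j) m \<longleftrightarrow> (\<lambda>i. m' i div 2 ^ j) \<in> dyadic_desc 1 m" for m'
    by (simp add: dyadic_desc_def div_mult2_eq [symmetric] zdiv_zmult2_eq [symmetric] mult.commute)
  then have "dyadic_desc (Suc j) m = (\<Union>c\<in>dyadic_desc 1 m. dyadic_desc j c)"
    by (auto simp: dyadic_desc_def fun_eq_iff)
  then show ?thesis
    by (simp add: sum.UNION_disjoint dyadic_desc_disjoint)
qed

text \<open>Splitting off the root, not the deepest generation, gives the recursion in which the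
  Bellman induction can apply its hypothesis to the children.\<close>

lemma tree_sum_Suc:
  fixes m :: "'n::finite \<Rightarrow> int"
  shows "tree_sum (Suc N) F k m = F k m + (\<Sum>c\<in>dyadic_desc 1 m. tree_sum N F (k - 1) c)"
proof -
  have "(\<Sum>j<N. \<Sum>m'\<in>dyadic_desc (Suc j) m. F (k - int (Suc j)) m')
      = (\<Sum>j<N. \<Sum>c\<in>dyadic_desc 1 m. \<Sum>m'\<in>dyadic_desc j c. F (k - 1 - int j) m')"
    by (simp only: sum_dyadic_desc_Suc) (simp add: algebra_simps)
  then show ?thesis
    by (simp add: tree_sum_def sum.lessThan_Suc_shift sum.swap[of _ _ "{..<N}"] del: sum.lessThan_Suc)
qed

lemma tree_sum_nonneg: "(\<And>k m. 0 \<le> F k m) \<Longrightarrow> 0 \<le> tree_sum N F k m"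
  by (simp add: tree_sum_def sum_nonneg)

lemma tree_sum_mono: "(\<And>k m. F k m \<le> G k m) \<Longrightarrow> tree_sum N F k m \<le> tree_sum N G k m"
  by (simp add: tree_sum_def sum_mono)

lemma tree_sum_add: "tree_sum N (\<lambda>k m. F k m + G k m) k m = tree_sum N F k m + tree_sum N G k m"
  by (simp add: tree_sum_def sum.distrib)

lemma tree_sum_cmult: "tree_sum N (\<lambda>k m. c * F k m) k m = c * tree_sum N F k m"
  by (simp add: tree_sum_def sum_distrib_left)

section \<open>Power inequalities and the Bellman induction\<close>

lemma powr_convex_nonneg:
  assumes "1 \<le> r" shows "convex_on {0..} (\<lambda>x::real. x powr r)"
proof (rule convex_onI)
  fix t x y :: real assume t: "0 < t" "t < 1" and "x \<in> {0..}" "y \<in> {0..}"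
  then have xy: "0 \<le> x" "0 \<le> y" by auto
  have le: "s powr r \<le> s" if "0 < s" "s < 1" for s :: real
    using powr_mono'[of 1 r s] that assms by simp
  show "((1 - t) *\<^sub>R x + t *\<^sub>R y) powr r \<le> (1 - t) * x powr r + t * y powr r"
  \<comment> \<open>With a zero endpoint the claim reduces to \<open>le\<close>; otherwise it is
    convexity on the positive reals.\<close>
  proof (cases "x = 0 \<or> y = 0")
    case True
    then show ?thesis
      using t xy le[of t] le[of "1 - t"] assms by (auto simp: powr_mult intro!: mult_right_mono)
  next
    case False
    then show ?thesis
      using convex_onD[OF powr_convex[OF assms], of t x y] t xy by auto
  qed
qed auto

text \<open>Jensen with weights \<open>w s / W\<close> at the points \<open>I s / w s\<close>. In
  other words, \<open>x^r w^(1-r)\<close> is convex and homogeneous of degree one, hence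
  subadditive; this is what makes the Bellman function superadditive over children.\<close>

lemma sum_powr_weighted:
  fixes w I :: "'a \<Rightarrow> real"
  assumes "finite S" "S \<noteq> {}" "1 \<le> r" and w: "\<And>s. s \<in> S \<Longrightarrow> 0 < w s" and I: "\<And>s. s \<in> S \<Longrightarrow> 0 \<le> I s"
  shows "(\<Sum>s\<in>S. I s) powr r * (\<Sum>s\<in>S. w s) powr (1 - r) \<le> (\<Sum>s\<in>S. I s powr r * w s powr (1 - r))"
proof -
  define W where "W = (\<Sum>s\<in>S. w s)"
  have W: "0 < W" unfolding W_def using assms by (intro sum_pos) auto
  have "(\<Sum>s\<in>S. (w s / W) *\<^sub>R (I s / w s)) powr r \<le> (\<Sum>s\<in>S. (w s / W) * (I s / w s) powr r)"
  proof (rule convex_on_sum[OF assms(1,2) powr_convex_nonneg[OF assms(3)]])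
    show "(\<Sum>s\<in>S. w s / W) = 1" using W by (simp add: W_def sum_divide_distrib [symmetric])
  qed (use W w I in \<open>auto simp: less_imp_le\<close>)
  also have "(\<Sum>s\<in>S. (w s / W) *\<^sub>R (I s / w s)) = (\<Sum>s\<in>S. I s) / W"
    using w by (auto simp: sum_divide_distrib intro!: sum.cong dest: w)
  finally have "((\<Sum>s\<in>S. I s) / W) powr r * W \<le> (\<Sum>s\<in>S. (w s / W) * (I s / w s) powr r) * W"
    using W by (simp add: mult_right_mono)
  also have "(\<Sum>s\<in>S. (w s / W) * (I s / w s) powr r) * W = (\<Sum>s\<in>S. I s powr r * w s powr (1 - r))"
    unfolding sum_distrib_right using W w I
    by (intro sum.cong) (auto simp: powr_divide less_imp_le powr_diff dest: w)
  also have "((\<Sum>s\<in>S. I s) / W) powr r * W = (\<Sum>s\<in>S. I s) powr r * W powr (1 - r)"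
    using W I by (simp add: powr_divide powr_diff sum_nonneg)
  finally show ?thesis by (simp add: W_def)
qed

lemma sum_powr_le:
  fixes I :: "'a \<Rightarrow> real"
  assumes "finite S" "1 \<le> r" "\<And>s. s \<in> S \<Longrightarrow> 0 \<le> I s"
  shows "(\<Sum>s\<in>S. I s) powr r \<le> real (card S) powr (r - 1) * (\<Sum>s\<in>S. I s powr r)"
proof (cases "S = {}")
  case False
  have "(\<Sum>s\<in>S. I s) powr r * real (card S) powr (1 - r) \<le> (\<Sum>s\<in>S. I s powr r)"
    using sum_powr_weighted[of S r "\<lambda>_. 1" I] assms False by simp
  then have "(\<Sum>s\<in>S. I s) powr r * real (card S) powr (1 - r) * real (card S) powr (r - 1)
      \<le> (\<Sum>s\<in>S. I s powr r) * real (card S) powr (r - 1)"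
    by (rule mult_right_mono) simp
  moreover have "real (card S) powr (1 - r) * real (card S) powr (r - 1) = 1"
    using False assms(1) by (simp add: powr_add [symmetric] card_gt_0_iff)
  ultimately show ?thesis by (simp add: mult.assoc) (simp add: mult.commute)
qed simp

text \<open>Mean value theorem for \<open>x^(1-r)\<close>: the intermediate point is below
  \<open>2 * V\<close>, so the derivative has size at least \<open>(r - 1) * (2 * V)^(-r)\<close>.
  It quantifies the drop of the Bellman function when the weight of the root is added.\<close>

lemma powr_one_minus_diff:
  fixes u l r :: real
  assumes "0 < u" "0 \<le> l" "1 < r" "u + l \<le> 2 * V"
  shows "(r - 1) * l * (2 * V) powr (- r) \<le> u powr (1 - r) - (u + l) powr (1 - r)"
proof (cases "l = 0")
  case False
  then have l: "0 < l" using assms by simp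
  have "((\<lambda>x. x powr (1 - r)) has_real_derivative (1 - r) * x powr (- r)) (at x)" if "u \<le> x" for x
    using that assms has_real_derivative_powr[of x "1 - r"] by simp
  from MVT2[of u "u + l", OF _ this] l
  obtain z where z: "u < z" "z < u + l"
    "(u + l) powr (1 - r) - u powr (1 - r) = (u + l - u) * ((1 - r) * z powr (- r))"
    by auto
  have "(2 * V) powr (- r) \<le> z powr (- r)"
    using z assms by (intro powr_mono2') auto
  then have "(r - 1) * l * (2 * V) powr (- r) \<le> (r - 1) * l * z powr (- r)"
    using assms by (intro mult_left_mono) auto
  with z show ?thesis by (simp add: algebra_simps)
qed simp

text \<open>The induction on the depth of the tree carries the Bellman function
  \<open>C (J - I^r / (V + \<Lambda>)^(r-1))\<close>, where \<open>\<Lambda>\<close> is the total weight of the descendants: it is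
  superadditive over children, and its decrease in \<open>\<Lambda>\<close> pays for the term at the root.\<close>
lemma carleson_embedding:
  fixes V lam I J :: "int \<Rightarrow> ('n::finite \<Rightarrow> int) \<Rightarrow> real"
  assumes r: "1 < r"
    and V: "\<And>k m. 0 < V k m" and Vsum: "\<And>k m. V k m = (\<Sum>c\<in>dyadic_desc 1 m. V (k - 1) c)"
    and I: "\<And>k m. 0 \<le> I k m" and Isum: "\<And>k m. I k m = (\<Sum>c\<in>dyadic_desc 1 m. I (k - 1) c)"
    and Jsum: "\<And>k m. J k m = (\<Sum>c\<in>dyadic_desc 1 m. J (k - 1) c)"
    and jensen: "\<And>k m. I k m powr r * V k m powr (1 - r) \<le> J k m"
    and lam: "\<And>k m. 0 \<le> lam k m" and packing: "\<And>N k m. tree_sum N lam k m \<le> V k m"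
  shows "tree_sum N (\<lambda>k m. lam k m * (I k m / V k m) powr r) k m \<le> 2 powr r / (r - 1) * J k m"
proof -
  \<comment> \<open>Chosen so that \<open>C * (r - 1) * (2 * V)^(-r) = V^(-r)\<close>: the drop
    given by \<open>powr_one_minus_diff\<close> then pays exactly for the term at the root.\<close>
  define C where "C = 2 powr r / (r - 1)"
  have C: "0 < C" using r by (simp add: C_def)
  have "tree_sum N (\<lambda>k m. lam k m * (I k m / V k m) powr r) k m
      + C * (I k m powr r * (V k m + tree_sum N lam k m) powr (1 - r)) \<le> C * J k m"
  proof (induction N arbitrary: k m)
    case 0
    show ?case using jensen[of k m] C by (simp add: tree_sum_def)
  next
    case (Suc N)
    let ?S = "\<lambda>N. tree_sum N (\<lambda>k m. lam k m * (I k m / V k m) powr r)"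
    define u where "u = V k m + (\<Sum>c\<in>dyadic_desc 1 m. tree_sum N lam (k - 1) c)"
    have u: "u = (\<Sum>c\<in>dyadic_desc 1 m. V (k - 1) c + tree_sum N lam (k - 1) c)"
      using Vsum[of k m] by (simp add: u_def sum.distrib)
    have u_lam: "V k m + tree_sum (Suc N) lam k m = u + lam k m"
      by (simp add: u_def tree_sum_Suc)
    have pos: "0 < V k m + tree_sum N lam k m" for N k m
      using V[of k m] tree_sum_nonneg[of lam N k m] lam by (simp add: add_pos_nonneg)
    have "0 < u" unfolding u by (rule sum_pos) (auto simp: pos)
    \<comment> \<open>Packing bounds the weight of the whole truncated tree, root included, by
      \<open>V\<close>; hence \<open>V + \<Lambda>\<close> never leaves the range from
      \<open>V\<close> to \<open>2 * V\<close>.\<close>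
    have "u + lam k m \<le> 2 * V k m"
      using packing[of "Suc N" k m] u_lam by simp
    with r \<open>0 < u\<close> lam have diff: "(r - 1) * lam k m * (2 * V k m) powr (- r)
        \<le> u powr (1 - r) - (u + lam k m) powr (1 - r)"
      by (intro powr_one_minus_diff) auto
    have "lam k m * (I k m / V k m) powr r
        = C * I k m powr r * ((r - 1) * lam k m * (2 * V k m) powr (- r))"
      using V[of k m] I[of k m] r
      by (simp add: C_def powr_divide powr_minus_divide powr_mult)
    also have "\<dots> \<le> C * I k m powr r * (u powr (1 - r) - (u + lam k m) powr (1 - r))"
      using diff C by (intro mult_left_mono) auto
    finally have root: "lam k m * (I k m / V k m) powr r
        + C * (I k m powr r * (u + lam k m) powr (1 - r)) \<le> C * (I k m powr r * u powr (1 - r))"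
      unfolding right_diff_distrib by (simp add: mult.assoc)
    define B where "B = (\<Sum>c\<in>dyadic_desc 1 m.
        I (k - 1) c powr r * (V (k - 1) c + tree_sum N lam (k - 1) c) powr (1 - r))"
    have "C * (I k m powr r * u powr (1 - r)) \<le> C * B"
      unfolding B_def u Isum[of k m] using C r pos I
      by (intro mult_left_mono sum_powr_weighted) auto
    moreover have "(\<Sum>c\<in>dyadic_desc 1 m. ?S N (k - 1) c) + C * B \<le> (\<Sum>c\<in>dyadic_desc 1 m. C * J (k - 1) c)"
      unfolding B_def sum_distrib_left sum.distrib [symmetric] by (intro sum_mono Suc.IH)
    moreover have "(\<Sum>c\<in>dyadic_desc 1 m. C * J (k - 1) c) = C * J k m"
      by (simp add: Jsum[of k m] sum_distrib_left)
    ultimately have "C * (I k m powr r * u powr (1 - r)) + (\<Sum>c\<in>dyadic_desc 1 m. ?S N (k - 1) c) \<le> C * J k m"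
      by linarith
    with root show ?case by (simp add: u_lam) (simp add: tree_sum_Suc)
  qed
  moreover have "0 \<le> C * (I k m powr r * (V k m + tree_sum N lam k m) powr (1 - r))"
    using C by simp
  ultimately show ?thesis by (simp add: C_def)
qed

section \<open>Shifted cubes and packing\<close>

definition shifts :: "int \<Rightarrow> ('n \<Rightarrow> int) set" where
  "shifts M = {e. \<forall>i. \<bar>e i\<bar> \<le> M}"

lemma finite_shifts [simp]: "finite (shifts M :: ('n::finite \<Rightarrow> int) set)"
proof -
  have "shifts M = (\<Pi>\<^sub>E i\<in>(UNIV :: 'n set). {- M..M})"
    by (auto simp: shifts_def PiE_def Pi_def abs_le_iff minus_le_iff)
  then show ?thesis by (simp add: finite_PiE)
qed

lemma zero_in_shifts: "0 \<le> M \<Longrightarrow> (\<lambda>_. 0) \<in> shifts M"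
  by (simp add: shifts_def)

lemma card_shifts_pos: "0 \<le> M \<Longrightarrow> 0 < card (shifts M :: ('n::finite \<Rightarrow> int) set)"
  using zero_in_shifts[of M] by (auto simp: card_gt_0_iff)

text \<open>Holds because \<open>M \<le> b * M\<close>. Consequently a cube within \<open>M\<close>
  steps of a descendant of \<open>R\<close> descends from a cube within \<open>M\<close> steps of
  \<open>R\<close>, with the same \<open>M\<close> in every generation.\<close>

lemma div_shift_bounds:
  fixes a b e M :: int
  assumes "0 < b" "\<bar>e\<bar> \<le> M"
  shows "\<bar>(a + e) div b - a div b\<bar> \<le> M"
proof -
  have M: "M \<le> b * M" using assms mult_right_mono[of 1 b M] by simp
  have "(a + e) div b \<le> (a + b * M) div b" "(a - b * M) div b \<le> (a + e) div b"
    by (rule zdiv_mono1; use assms M in linarith)+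
  moreover have "(a + b * M) div b = a div b + M"
    using assms by simp
  moreover have "(a - b * M) div b = a div b - M"
    using div_mult_self2[of b a "- M"] assms by simp
  ultimately show ?thesis by linarith
qed

text \<open>Shifted descendants may leave the cube, but by \<open>div_shift_bounds\<close> they stay
  below its neighbours; translation is injective, so none is counted twice.\<close>

lemma sum_dyadic_desc_shift_le:
  fixes F :: "('n::finite \<Rightarrow> int) \<Rightarrow> real"
  assumes e: "e \<in> shifts M" and F: "\<And>m. 0 \<le> F m"
  shows "(\<Sum>m'\<in>dyadic_desc j m. F (\<lambda>i. m' i + e i))
    \<le> (\<Sum>d\<in>shifts M. \<Sum>m'\<in>dyadic_desc j (\<lambda>i. m i + d i). F m')"
proof -
  let ?t = "\<lambda>m' i. m' i + e i"
  have inj: "inj_on ?t A" for A by (auto simp: inj_on_def fun_eq_iff)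
  have "\<exists>d\<in>shifts M. ?t m' \<in> dyadic_desc j (\<lambda>i. m i + d i)" if "m' \<in> dyadic_desc j m" for m'
    using that e div_shift_bounds[of "2 ^ j" "e i" M "m' i" for i]
    by (intro bexI[of _ "\<lambda>i. (m' i + e i) div 2 ^ j - m' i div 2 ^ j"])
       (auto simp: dyadic_desc_def shifts_def)
  then have sub: "?t ` dyadic_desc j m \<subseteq> (\<Union>d\<in>shifts M. dyadic_desc j (\<lambda>i. m i + d i))"
    by auto
  have "(\<Sum>m'\<in>dyadic_desc j m. F (?t m')) = sum F (?t ` dyadic_desc j m)"
    by (simp add: sum.reindex[OF inj] o_def)
  also have "\<dots> \<le> sum F (\<Union>d\<in>shifts M. dyadic_desc j (\<lambda>i. m i + d i))"
    using sub F by (intro sum_mono2) auto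
  also have "\<dots> = (\<Sum>d\<in>shifts M. \<Sum>m'\<in>dyadic_desc j (\<lambda>i. m i + d i). F m')"
    by (intro sum.UNION_disjoint ballI impI dyadic_desc_disjoint) (auto simp: fun_eq_iff)
  finally show ?thesis .
qed

lemma tree_sum_shift_le:
  fixes F :: "int \<Rightarrow> ('n::finite \<Rightarrow> int) \<Rightarrow> real"
  assumes e: "e \<in> shifts M" and F: "\<And>k m. 0 \<le> F k m"
  shows "tree_sum N (\<lambda>k m. F k (\<lambda>i. m i + e i)) k m \<le> (\<Sum>d\<in>shifts M. tree_sum N F k (\<lambda>i. m i + d i))"
proof -
  have "tree_sum N (\<lambda>k m. F k (\<lambda>i. m i + e i)) k m
      \<le> (\<Sum>j<N. \<Sum>d\<in>shifts M. \<Sum>m'\<in>dyadic_desc j (\<lambda>i. m i + d i). F (k - int j) m')"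
    unfolding tree_sum_def by (intro sum_mono sum_dyadic_desc_shift_le assms)
  then show ?thesis
    unfolding tree_sum_def by (subst sum.swap)
qed

definition cube_vol :: "int \<Rightarrow> ('n::finite \<Rightarrow> int) \<Rightarrow> real" where
  "cube_vol k m = 2 powr (real_of_int k * real CARD('n))"

lemma cube_vol_pos [simp]: "0 < cube_vol k m"
  by (simp add: cube_vol_def)

lemma cube_vol_neq_0 [simp]: "cube_vol k m \<noteq> 0"
  by (simp add: cube_vol_def)

lemma abs_cube_vol [simp]: "\<bar>cube_vol k m\<bar> = cube_vol k m"
  by (simp add: cube_vol_def)

lemma cube_vol_sum:
  fixes m :: "'n::finite \<Rightarrow> int"
  shows "cube_vol k m = (\<Sum>c\<in>dyadic_desc j m. cube_vol (k - int j) c)"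
proof -
  have "(\<Sum>c\<in>dyadic_desc j m. cube_vol (k - int j) c) = real (card (dyadic_desc j m)) * 2 powr (real_of_int (k - int j) * real CARD('n))"
    by (simp add: cube_vol_def)
  also have "\<dots> = 2 powr (real j * real CARD('n)) * 2 powr (real_of_int (k - int j) * real CARD('n))"
    by (simp add: card_dyadic_desc powr_realpow [symmetric])
  also have "\<dots> = cube_vol k m"
    by (simp add: cube_vol_def powr_add [symmetric] algebra_simps)
  finally show ?thesis by simp
qed

text \<open>This is \<open>|R|^(1 + \<alpha>/n)\<close> times the \<open>b\<close>-average of \<open>f\<close> over the cube \<open>R\<close> shifted
  by \<open>e\<close>, where \<open>U\<close> is the integral of \<open>f^b\<close>.\<close>
definition weight :: "real \<Rightarrow> real \<Rightarrow> ('n \<Rightarrow> int) \<Rightarrow> (int \<Rightarrow> ('n::finite \<Rightarrow> int) \<Rightarrow> real) \<Rightarrow> int \<Rightarrow> ('n \<Rightarrow> int) \<Rightarrow> real" where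
  "weight \<alpha> b e U k m = 2 powr (real_of_int k * \<alpha>) * cube_vol k m powr (1 - 1 / b) * U k (\<lambda>i. m i + e i) powr (1 / b)"

text \<open>The Morrey bound is used only for neighbours of the top cube, so that going down \<open>j\<close> generations
  gains the factor \<open>2^(-j \<alpha>)\<close>.\<close>
lemma weight_level_sum:
  fixes U :: "int \<Rightarrow> ('n::finite \<Rightarrow> int) \<Rightarrow> real"
  assumes b: "1 \<le> b" and e: "e \<in> shifts M" and U: "\<And>k m. 0 \<le> U k m"
    and Usum: "\<And>j k m. U k m = (\<Sum>c\<in>dyadic_desc j m. U (k - int j) c)"
    and morrey: "\<And>k m. U k m \<le> 2 powr (- real_of_int k * \<alpha> * b) * cube_vol k m"
  shows "(\<Sum>m'\<in>dyadic_desc j m. weight \<alpha> b e U (k - int j) m')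
    \<le> real (card (shifts M :: ('n \<Rightarrow> int) set)) powr (1 / b) * (2 powr (- \<alpha>)) ^ j * cube_vol k m"
proof -
  let ?n = "real CARD('n)" and ?K = "real (card (shifts M :: ('n \<Rightarrow> int) set))"
  define S where "S = (\<Sum>m'\<in>dyadic_desc j m. U (k - int j) (\<lambda>i. m' i + e i) powr (1 / b))"
  have S: "0 \<le> S" unfolding S_def by (intro sum_nonneg) simp
  have "S powr b \<le> real (card (dyadic_desc j m)) powr (b - 1)
      * (\<Sum>m'\<in>dyadic_desc j m. (U (k - int j) (\<lambda>i. m' i + e i) powr (1 / b)) powr b)"
    unfolding S_def using b by (intro sum_powr_le) auto
  also have "(\<Sum>m'\<in>dyadic_desc j m. (U (k - int j) (\<lambda>i. m' i + e i) powr (1 / b)) powr b)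
      = (\<Sum>m'\<in>dyadic_desc j m. U (k - int j) (\<lambda>i. m' i + e i))"
    using b U by (intro sum.cong) (auto simp: powr_powr)
  also have "\<dots> \<le> (\<Sum>d\<in>shifts M. \<Sum>m'\<in>dyadic_desc j (\<lambda>i. m i + d i). U (k - int j) m')"
    by (rule sum_dyadic_desc_shift_le[OF e U])
  also have "\<dots> = (\<Sum>d\<in>shifts M. U k (\<lambda>i. m i + d i))"
    by (simp add: Usum[symmetric])
  also have "\<dots> \<le> (\<Sum>d\<in>(shifts M :: ('n \<Rightarrow> int) set). 2 powr (- real_of_int k * \<alpha> * b) * 2 powr (real_of_int k * ?n))"
    by (intro sum_mono order_trans[OF morrey]) (simp add: cube_vol_def)
  also have "\<dots> = ?K * 2 powr (- real_of_int k * \<alpha> * b + real_of_int k * ?n)"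
    unfolding powr_add by simp
  also have "real (card (dyadic_desc j m)) = 2 powr (real j * ?n)"
    by (simp add: card_dyadic_desc powr_realpow [symmetric])
  finally have "S powr b \<le> (2 powr (real j * ?n)) powr (b - 1) * (?K * 2 powr (- real_of_int k * \<alpha> * b + real_of_int k * ?n))"
    by (simp add: mult_left_mono)
  then have "(S powr b) powr (1 / b) \<le> ((2 powr (real j * ?n)) powr (b - 1) * (?K * 2 powr (- real_of_int k * \<alpha> * b + real_of_int k * ?n))) powr (1 / b)"
    using b by (intro powr_mono2) auto
  also have "(S powr b) powr (1 / b) = S"
    using S b by (simp add: powr_powr)
  also have "((2 powr (real j * ?n)) powr (b - 1) * (?K * 2 powr (- real_of_int k * \<alpha> * b + real_of_int k * ?n))) powr (1 / b)
      = ?K powr (1 / b) * 2 powr ((real j * ?n * (b - 1) + (- real_of_int k * \<alpha> * b + real_of_int k * ?n)) * (1 / b))"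
    by (simp add: powr_mult powr_powr powr_add [symmetric] add_divide_distrib)
  also have "(real j * ?n * (b - 1) + (- real_of_int k * \<alpha> * b + real_of_int k * ?n)) * (1 / b)
     = real j * ?n * (1 - 1 / b) - real_of_int k * \<alpha> + real_of_int k * ?n * (1 / b)"
    using b by (simp add: field_simps)
  finally have S_le: "S \<le> ?K powr (1 / b) * 2 powr (real j * ?n * (1 - 1 / b) - real_of_int k * \<alpha> + real_of_int k * ?n * (1 / b))" .
  have "(\<Sum>m'\<in>dyadic_desc j m. weight \<alpha> b e U (k - int j) m')
      = 2 powr (real_of_int (k - int j) * \<alpha> + real_of_int (k - int j) * ?n * (1 - 1 / b)) * S"
    by (simp add: S_def weight_def cube_vol_def sum_distrib_left powr_powr powr_add)
  also have "\<dots> \<le> 2 powr (real_of_int (k - int j) * \<alpha> + real_of_int (k - int j) * ?n * (1 - 1 / b))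
      * (?K powr (1 / b) * 2 powr (real j * ?n * (1 - 1 / b) - real_of_int k * \<alpha> + real_of_int k * ?n * (1 / b)))"
    using S_le by (intro mult_left_mono) auto
  also have "\<dots> = ?K powr (1 / b) * 2 powr ((real_of_int (k - int j) * \<alpha> + real_of_int (k - int j) * ?n * (1 - 1 / b))
      + (real j * ?n * (1 - 1 / b) - real_of_int k * \<alpha> + real_of_int k * ?n * (1 / b)))"
    by (simp add: powr_add)
  \<comment> \<open>All terms in \<open>b\<close> cancel: the factor
    \<open>2^(j n (1 - 1/b))\<close> lost in the power mean over the descendants is regained from
    the volume power of the smaller cubes.\<close>
  also have "(real_of_int (k - int j) * \<alpha> + real_of_int (k - int j) * ?n * (1 - 1 / b))
      + (real j * ?n * (1 - 1 / b) - real_of_int k * \<alpha> + real_of_int k * ?n * (1 / b))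
    = - \<alpha> * real j + real_of_int k * ?n"
    by (simp add: algebra_simps)
  also have "2 powr (- \<alpha> * real j + real_of_int k * ?n) = (2 powr (- \<alpha>)) ^ j * cube_vol k m"
    by (simp only: cube_vol_def powr_add powr_powr [symmetric]) (simp add: powr_realpow)
  finally show ?thesis by (simp add: mult.assoc)
qed

text \<open>The level bounds form a geometric series of ratio \<open>2^(-\<alpha>) < 1\<close>,
  whatever the depth \<open>N\<close>.\<close>

lemma weight_packing:
  fixes U :: "int \<Rightarrow> ('n::finite \<Rightarrow> int) \<Rightarrow> real"
  assumes \<alpha>: "0 < \<alpha>" and "1 \<le> b" and "e \<in> shifts M" and "\<And>k m. 0 \<le> U k m"
    and "\<And>j k m. U k m = (\<Sum>c\<in>dyadic_desc j m. U (k - int j) c)"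
    and "\<And>k m. U k m \<le> 2 powr (- real_of_int k * \<alpha> * b) * cube_vol k m"
  shows "tree_sum N (weight \<alpha> b e U) k m
    \<le> real (card (shifts M :: ('n \<Rightarrow> int) set)) powr (1 / b) / (1 - 2 powr (- \<alpha>)) * cube_vol k m"
proof -
  define s :: real where "s = 2 powr (- \<alpha>)"
  have s: "0 \<le> s" "s < 1" using \<alpha> by (auto simp: s_def powr_less_one)
  let ?K = "real (card (shifts M :: ('n \<Rightarrow> int) set)) powr (1 / b)"
  have "tree_sum N (weight \<alpha> b e U) k m \<le> (\<Sum>j<N. ?K * s ^ j * cube_vol k m)"
    unfolding tree_sum_def s_def by (intro sum_mono weight_level_sum assms)
  also have "\<dots> = ?K * cube_vol k m * (\<Sum>j<N. s ^ j)"
    unfolding sum_distrib_left by (simp add: mult_ac)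
  also have "\<dots> \<le> ?K * cube_vol k m * (1 / (1 - s))"
    using s by (intro mult_left_mono) (auto simp: sum_gp_strict divide_right_mono cube_vol_def)
  finally show ?thesis by (simp add: s_def)
qed

section \<open>Dyadic cubes and averages\<close>

definition cube_index :: "int \<Rightarrow> real^'n \<Rightarrow> 'n::finite \<Rightarrow> int" where
  "cube_index k x = (\<lambda>i. \<lfloor>x $ i / 2 powr real_of_int k\<rfloor>)"

lemma mem_dyadic_cube_iff: "x \<in> dyadic_cube k m \<longleftrightarrow> cube_index k x = m"
proof -
  have "2 powr real_of_int k * real_of_int z \<le> y \<and> y < 2 powr real_of_int k * (real_of_int z + 1)
      \<longleftrightarrow> \<lfloor>y / 2 powr real_of_int k\<rfloor> = z" for y z
    by (simp add: floor_eq_iff pos_le_divide_eq pos_divide_less_eq mult.commute)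
  then show ?thesis
    by (auto simp: dyadic_cube_def cube_index_def fun_eq_iff)
qed

text \<open>Rounding down before or after dividing by \<open>2^j\<close> gives the same integer.
  This identifies the integer-division tree \<open>dyadic_desc\<close> with inclusion of
  cubes.\<close>

lemma cube_index_div: "cube_index (k - int j) x i div 2 ^ j = cube_index k x i"
proof -
  have "2 powr real_of_int k = (2::real) powr real_of_int (k - int j) * 2 ^ j"
    by (simp add: powr_realpow [symmetric] powr_add [symmetric])
  then show ?thesis
    using floor_divide_real_eq_div[of "2 ^ j" "x $ i / 2 powr real_of_int (k - int j)"]
    by (simp add: cube_index_def)
qed

lemma cube_index_in_desc: "cube_index (k - int j) x \<in> dyadic_desc j m \<longleftrightarrow> x \<in> dyadic_cube k m"
  by (simp add: dyadic_desc_def mem_dyadic_cube_iff cube_index_div fun_eq_iff)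

lemma indicator_dyadic_cube:
  "indicator (dyadic_cube k m) x = (if cube_index k x = m then 1 else 0 :: 'a::zero_neq_one)"
  by (simp add: indicator_def mem_dyadic_cube_iff)

text \<open>Each generation has exactly one cube containing \<open>x\<close>, so only one term can
  survive. Sums over cubes thereby become sums over scales along the chain of
  \<open>x\<close>.\<close>

lemma sum_dyadic_desc_indicator:
  fixes F :: "('n::finite \<Rightarrow> int) \<Rightarrow> 'a::semiring_1"
  shows "(\<Sum>m'\<in>dyadic_desc j m. F m' * indicator (dyadic_cube (k - int j) m') x)
    = F (cube_index (k - int j) x) * indicator (dyadic_cube k m) x"
proof -
  have "(\<Sum>m'\<in>dyadic_desc j m. F m' * indicator (dyadic_cube (k - int j) m') x)
      = (\<Sum>m'\<in>dyadic_desc j m. if cube_index (k - int j) x = m' then F m' else 0)"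
    by (intro sum.cong) (auto simp: indicator_dyadic_cube)
  also have "\<dots> = (if cube_index (k - int j) x \<in> dyadic_desc j m then F (cube_index (k - int j) x) else 0)"
    by (simp add: sum.delta')
  finally show ?thesis
    by (simp add: cube_index_in_desc indicator_def)
qed

lemma indicator_dyadic_cube_sum:
  fixes m :: "'n::finite \<Rightarrow> int"
  shows "indicator (dyadic_cube k m) x
    = (\<Sum>m'\<in>dyadic_desc j m. indicator (dyadic_cube (k - int j) m') x :: 'a::semiring_1)"
  using sum_dyadic_desc_indicator[where F = "\<lambda>_. 1 :: 'a" and j = j and k = k and x = x and m = m] by simp

lemma dyadic_cube_borel [measurable]: "dyadic_cube k m \<in> sets borel"
proof -
  have "dyadic_cube k m = {x. \<forall>i. \<lfloor>x $ i / 2 powr real_of_int k\<rfloor> = m i}"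
    by (auto simp: mem_dyadic_cube_iff cube_index_def fun_eq_iff)
  then show ?thesis by simp
qed

text \<open>The half-open cube lies between the open and the closed box with the same corners, which
  have equal measure.\<close>

lemma emeasure_dyadic_cube:
  fixes m :: "'n::finite \<Rightarrow> int"
  shows "emeasure lborel (dyadic_cube k m) = ennreal (cube_vol k m)"
proof -
  define l :: "real^'n" where "l = (\<chi> i. 2 powr real_of_int k * real_of_int (m i))"
  define u :: "real^'n" where "u = (\<chi> i. 2 powr real_of_int k * (real_of_int (m i) + 1))"
  have le: "l $ i \<le> u $ i" and diff: "u $ i - l $ i = 2 powr real_of_int k" for i
    by (simp_all add: l_def u_def distrib_left)
  have sub: "box l u \<subseteq> dyadic_cube k m" "dyadic_cube k m \<subseteq> cbox l u"
    by (auto simp: dyadic_cube_def mem_box_cart l_def u_def less_imp_le)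
  have "(\<Prod>b\<in>Basis. (u - l) \<bullet> b) = (\<Prod>i\<in>UNIV. (u - l) $ i)"
    unfolding Basis_vec_def by (simp add: prod.UNION_disjoint inner_axis axis_eq_axis)
  also have "\<dots> = cube_vol k m"
    by (simp add: diff cube_vol_def powr_powr [symmetric] powr_realpow)
  finally have p: "(\<Prod>b\<in>Basis. (u - l) \<bullet> b) = cube_vol k m" .
  have B: "\<forall>b\<in>Basis. l \<bullet> b \<le> u \<bullet> b"
    using le by (auto simp: Basis_vec_def inner_axis)
  have "emeasure lborel (dyadic_cube k m) \<le> ennreal (cube_vol k m)"
    using emeasure_mono[OF sub(2), of lborel] B p by simp
  moreover have "ennreal (cube_vol k m) \<le> emeasure lborel (dyadic_cube k m)"
    using emeasure_mono[OF sub(1), of lborel] B p by simp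
  ultimately show ?thesis by simp
qed

lemma measure_lborel_dyadic_cube: "measure lborel (dyadic_cube k m) = cube_vol k m"
  by (simp add: measure_def emeasure_dyadic_cube less_imp_le)

lemma measure_lebesgue_dyadic_cube: "measure lebesgue (dyadic_cube k m) = cube_vol k m"
  by (simp add: measure_completion measure_lborel_dyadic_cube)

section \<open>Integrals over cubes as functions on the tree\<close>

definition locally_integrable :: "(real^'n::finite \<Rightarrow> real) \<Rightarrow> bool" where
  "locally_integrable h \<longleftrightarrow> (\<forall>k m. integrable lborel (\<lambda>x. indicator (dyadic_cube k m) x * h x))"

definition cube_int :: "(real^'n::finite \<Rightarrow> real) \<Rightarrow> int \<Rightarrow> ('n \<Rightarrow> int) \<Rightarrow> real" where
  "cube_int h k m = (LINT x|lborel. indicator (dyadic_cube k m) x * h x)"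

lemma cube_int_nonneg: "(\<And>x. 0 \<le> h x) \<Longrightarrow> 0 \<le> cube_int h k m"
  by (simp add: cube_int_def)

lemma cube_int_sum:
  assumes "locally_integrable h"
  shows "cube_int h k m = (\<Sum>c\<in>dyadic_desc j m. cube_int h (k - int j) c)"
proof -
  have "cube_int h k m = (LINT x|lborel. (\<Sum>c\<in>dyadic_desc j m. indicator (dyadic_cube (k - int j) c) x * h x))"
    unfolding cube_int_def sum_distrib_right [symmetric] indicator_dyadic_cube_sum[where k = k and m = m and j = j] ..
  also have "\<dots> = (\<Sum>c\<in>dyadic_desc j m. cube_int h (k - int j) c)"
    unfolding cube_int_def using assms by (intro Bochner_Integration.integral_sum) (auto simp: locally_integrable_def)
  finally show ?thesis .
qed

text \<open>The graph of \<open>t^r\<close> lies above its tangent at \<open>x\<close>. Young's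
  inequality for \<open>t\<close> and \<open>x^(r-1)\<close> gives this at \<open>x = 0\<close> too,
  without differentiation.\<close>

lemma powr_tangent:
  fixes t x r :: real
  assumes "0 \<le> t" "0 \<le> x" "1 < r"
  shows "x powr r + r * x powr (r - 1) * (t - x) \<le> t powr r"
proof -
  have xr: "x powr (r - 1) * x = x powr r" "(x powr (r - 1)) powr (r / (r - 1)) = x powr r"
    using assms powr_add[of x "r - 1" 1] by (simp_all add: powr_powr powr_mult_base)
  have "t * x powr (r - 1) \<le> t powr r / r + (x powr (r - 1)) powr (r / (r - 1)) / (r / (r - 1))"
    using assms by (intro Youngs_inequality) (auto simp: field_simps)
  then have "r * (t * x powr (r - 1)) \<le> r * (t powr r / r + x powr r / (r / (r - 1)))"
    using assms xr by (intro mult_left_mono) auto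
  also have "\<dots> = t powr r + (r - 1) * x powr r"
    using assms by (simp add: field_simps)
  finally show ?thesis
    using xr(1) by (simp add: algebra_simps)
qed

text \<open>The tangent inequality at the mean \<open>x\<close> of \<open>h\<close> is integrated
  over the cube; its linear part integrates to zero. This supplies the hypothesis
  \<open>jensen\<close> of \<open>carleson_embedding\<close>.\<close>

lemma cube_int_jensen:
  assumes "1 < r" "\<And>x. 0 \<le> h x" "locally_integrable h" "locally_integrable (\<lambda>x. h x powr r)"
  shows "cube_int h k m powr r * cube_vol k m powr (1 - r) \<le> cube_int (\<lambda>x. h x powr r) k m"
proof -
  let ?D = "dyadic_cube k m" and ?V = "cube_vol k m"
  define x where "x = cube_int h k m / ?V"
  have x: "0 \<le> x" using assms(2) by (simp add: x_def cube_int_nonneg less_imp_le)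
  have D: "integrable lborel (\<lambda>y. indicator ?D y :: real)" "(LINT y|lborel. indicator ?D y) = ?V"
    by (auto simp: integrable_indicator_iff emeasure_dyadic_cube measure_lborel_dyadic_cube)
  have h: "integrable lborel (\<lambda>y. indicator ?D y * h y)" "integrable lborel (\<lambda>y. indicator ?D y * h y powr r)"
    using assms(3,4) by (auto simp: locally_integrable_def)
  have "(LINT y|lborel. (x powr r - r * x powr (r - 1) * x) * indicator ?D y + r * x powr (r - 1) * (indicator ?D y * h y))
      \<le> (LINT y|lborel. indicator ?D y * h y powr r)"
  proof (intro integral_mono)
    show "(x powr r - r * x powr (r - 1) * x) * indicator ?D y + r * x powr (r - 1) * (indicator ?D y * h y)
        \<le> indicator ?D y * h y powr r" for y
      using powr_tangent[OF assms(2) x assms(1), of y] by (auto simp: indicator_def algebra_simps)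
  qed (use D(1) h in auto)
  also have "(LINT y|lborel. (x powr r - r * x powr (r - 1) * x) * indicator ?D y + r * x powr (r - 1) * (indicator ?D y * h y))
      = (x powr r - r * x powr (r - 1) * x) * ?V + r * x powr (r - 1) * cube_int h k m"
    using D h(1) by (subst Bochner_Integration.integral_add) (auto simp: cube_int_def)
  also have "\<dots> = x powr r * ?V"
    by (simp add: x_def algebra_simps)
  also have "\<dots> = cube_int h k m powr r * ?V powr (1 - r)"
    using assms(2) by (simp add: x_def powr_divide powr_diff cube_int_nonneg less_imp_le)
  finally show ?thesis by (simp add: cube_int_def)
qed

lemma cube_int_carleson:
  fixes h :: "real^'n::finite \<Rightarrow> real"
  assumes "1 < r" "\<And>x. 0 \<le> h x" "locally_integrable h" "locally_integrable (\<lambda>x. h x powr r)"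
    and "\<And>k m. 0 \<le> lam k m" and "\<And>N k m. tree_sum N lam k m \<le> cube_vol k m"
  shows "tree_sum N (\<lambda>k m. lam k m * (cube_int h k m / cube_vol k m) powr r) k m
    \<le> 2 powr r / (r - 1) * cube_int (\<lambda>x. h x powr r) k m"
proof (rule carleson_embedding)
  show "cube_int h k m = (\<Sum>c\<in>dyadic_desc 1 m. cube_int h (k - 1) c)" for k m
    using cube_int_sum[OF assms(3), of k m 1] by simp
  show "cube_int (\<lambda>x. h x powr r) k m = (\<Sum>c\<in>dyadic_desc 1 m. cube_int (\<lambda>x. h x powr r) (k - 1) c)" for k m
    using cube_int_sum[OF assms(4), of k m 1] by simp
  show "(cube_vol k m :: real) = (\<Sum>c\<in>dyadic_desc 1 m. cube_vol (k - 1) c)" for k and m :: "'n \<Rightarrow> int"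
    using cube_vol_sum[of k m 1] by simp
qed (use assms in \<open>auto intro: cube_int_nonneg cube_int_jensen\<close>)

section \<open>The dyadic operator on Lebesgue spaces\<close>

text \<open>Either the first or the second term dominates alone, according to the case split. The
  free \<open>eps\<close> serves to make the first term small enough to be absorbed.\<close>

lemma young_weighted:
  fixes s t eps q :: real
  assumes "0 \<le> s" "0 \<le> t" "0 < eps" "1 < q"
  shows "s * t \<le> eps * s powr (q / (q - 1)) + eps powr (1 - q) * t powr q"
proof (cases "t \<le> eps * s powr (1 / (q - 1))")
  case True
  have e: "q / (q - 1) = 1 + 1 / (q - 1)" using assms by (simp add: field_simps)
  have "s * t \<le> s * (eps * s powr (1 / (q - 1)))"
    using True assms by (intro mult_left_mono) auto
  also have "\<dots> = eps * s powr (q / (q - 1))"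
    unfolding e using assms by (simp add: powr_add)
  finally show ?thesis by (simp add: add_increasing2)
next
  case False
  then have "s powr (1 / (q - 1)) \<le> t / eps"
    using assms by (simp add: pos_le_divide_eq mult.commute)
  then have "(s powr (1 / (q - 1))) powr (q - 1) \<le> (t / eps) powr (q - 1)"
    using assms by (intro powr_mono2) auto
  then have "s \<le> (t / eps) powr (q - 1)"
    using assms by (simp add: powr_powr)
  then have "s * t \<le> (t / eps) powr (q - 1) * t"
    using assms by (intro mult_right_mono) auto
  also have "\<dots> = eps powr (1 - q) * t powr q"
  proof (cases "t = 0")
    case f: False
    have "eps powr (1 - q) = inverse (eps powr (q - 1))"
      using powr_minus[of eps "q - 1"] by simp
    then show ?thesis
      using assms f by (simp add: powr_divide powr_diff field_simps)
  qed simp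
  finally show ?thesis using assms by (simp add: add_increasing)
qed

lemma integrable_bounded_on_cube:
  assumes [measurable]: "h \<in> borel_measurable borel" and "\<And>x. x \<in> dyadic_cube k m \<Longrightarrow> \<bar>h x\<bar> \<le> B"
  shows "integrable lborel (\<lambda>x. indicator (dyadic_cube k m) x * h x :: real)"
proof (rule Bochner_Integration.integrable_bound)
  show "integrable lborel (\<lambda>x. B * indicator (dyadic_cube k m) x)"
    by (auto simp: integrable_indicator_iff emeasure_dyadic_cube)
  show "AE x in lborel. norm (indicator (dyadic_cube k m) x * h x) \<le> norm (B * indicator (dyadic_cube k m) x)"
    using assms(2) by (intro AE_I2) (auto simp: indicator_def intro: order_trans[OF _ abs_ge_self])
qed simp

text \<open>This is \<open>2 * eps^(1-q)\<close> with \<open>eps = 1 / (2 * c)\<close>, where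
  \<open>c = 2^q' / (q' - 1)\<close> is the embedding constant for the conjugate exponent
  \<open>q' = q / (q - 1)\<close>; the leading 2 comes from absorbing one half.\<close>

definition local_const :: "real \<Rightarrow> real" where
  "local_const q = 2 * ((q / (q - 1) - 1) / (2 * 2 powr (q / (q - 1)))) powr (1 - q)"

definition tree_op :: "nat \<Rightarrow> (int \<Rightarrow> ('n::finite \<Rightarrow> int) \<Rightarrow> real) \<Rightarrow> int \<Rightarrow> ('n \<Rightarrow> int) \<Rightarrow> real^'n \<Rightarrow> real" where
  "tree_op N a k m x = tree_sum N (\<lambda>k m. a k m * indicator (dyadic_cube k m) x) k m"

lemma tree_op_measurable [measurable]: "tree_op N a k m \<in> borel_measurable borel"
  unfolding tree_op_def tree_sum_def by measurable

lemma tree_op_eq: "tree_op N a k m x = (\<Sum>j<N. a (k - int j) (cube_index (k - int j) x)) * indicator (dyadic_cube k m) x"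
  by (simp add: tree_op_def tree_sum_def sum_dyadic_desc_indicator sum_distrib_right)

lemma tree_op_nonneg: "(\<And>k m. 0 \<le> a k m) \<Longrightarrow> 0 \<le> tree_op N a k m x"
  by (simp add: tree_op_def tree_sum_nonneg)

lemma tree_op_le: 
  assumes "\<And>k m. 0 \<le> a k m" shows "tree_op N a k m x \<le> tree_sum N a k m"
  unfolding tree_op_def by (intro tree_sum_mono) (auto simp: assms indicator_def)

lemma tree_op_integral:
  assumes "locally_integrable h"
  shows "(LINT x|lborel. tree_op N a k m x * h x) = tree_sum N (\<lambda>k m. a k m * cube_int h k m) k m"
proof -
  have "(LINT x|lborel. tree_op N a k m x * h x) = (LINT x|lborel. (\<Sum>j<N. \<Sum>m'\<in>dyadic_desc j m.
      a (k - int j) m' * (indicator (dyadic_cube (k - int j) m') x * h x)))"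
    by (simp only: tree_op_def tree_sum_def sum_distrib_right mult.assoc)
  also have "\<dots> = (\<Sum>j<N. \<Sum>m'\<in>dyadic_desc j m. a (k - int j) m' * cube_int h (k - int j) m')"
    using assms by (simp add: cube_int_def locally_integrable_def)
  finally show ?thesis by (simp add: tree_sum_def)
qed

text \<open>Duality: the integral is tested against \<open>\<Phi>^(q-1)\<close>, whose averages are controlled by the
  embedding theorem with exponent \<open>q/(q-1)\<close>, and half of the left side is absorbed.\<close>
lemma tree_op_powr_integral:
  fixes lam v :: "int \<Rightarrow> ('n::finite \<Rightarrow> int) \<Rightarrow> real" and N :: nat and k :: int and m :: "'n \<Rightarrow> int"
  assumes q: "1 < q" and lam: "\<And>k m. 0 \<le> lam k m" and v: "\<And>k m. 0 \<le> v k m"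
    and packing: "\<And>N k m. tree_sum N lam k m \<le> cube_vol k m"
  defines "\<Phi> \<equiv> tree_op N (\<lambda>k m. lam k m / cube_vol k m * v k m) k m"
  shows "integrable lborel (\<lambda>x. \<Phi> x powr q)"
    and "(LINT x|lborel. \<Phi> x powr q) \<le> local_const q * tree_sum N (\<lambda>k m. lam k m * v k m powr q) k m"
proof -
  define a where "a = (\<lambda>k m. lam k m / cube_vol k m * v k m)"
  have a: "0 \<le> a k m" for k m
    using lam v by (simp add: a_def less_imp_le)
  have \<Phi>: "\<Phi> = tree_op N a k m" by (simp add: \<Phi>_def a_def)
  have [measurable]: "\<Phi> \<in> borel_measurable borel" unfolding \<Phi> by simp
  have \<Phi>0: "0 \<le> \<Phi> x" for x unfolding \<Phi> by (intro tree_op_nonneg a)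
  have powr_bound: "\<bar>\<Phi> x powr p\<bar> \<le> tree_sum N a k m powr p" if "0 \<le> p" for p x
    using that \<Phi>0[of x] tree_op_le[of a N k m x, OF a] by (auto simp: \<Phi> intro: powr_mono2)
  have supp: "\<Phi> x powr p = indicator (dyadic_cube k m) x * \<Phi> x powr p" for x p
    by (simp add: \<Phi> tree_op_eq indicator_def)
  define q' where "q' = q / (q - 1)"
  have q': "1 < q'" and qq: "(q - 1) * q' = q" using q by (auto simp: q'_def field_simps)
  \<comment> \<open>A truncated tree yields a bounded function supported in one cube, so
    \<open>X\<close> below is a genuine finite integral; the absorption depends on this.\<close>
  show int: "integrable lborel (\<lambda>x. \<Phi> x powr q)"
    using integrable_bounded_on_cube[of "\<lambda>x. \<Phi> x powr q" k m, OF _ powr_bound] q by (simp only: supp [symmetric]) simp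
  define X where "X = (LINT x|lborel. \<Phi> x powr q)"
  define h where "h = (\<lambda>x. \<Phi> x powr (q - 1))"
  have h_pow: "(\<lambda>x. h x powr q') = (\<lambda>x. \<Phi> x powr q)"
    using qq by (simp add: h_def powr_powr)
  have h: "locally_integrable h" "locally_integrable (\<lambda>x. h x powr q')"
    unfolding h_pow unfolding h_def locally_integrable_def using q
    by (auto intro!: integrable_bounded_on_cube powr_bound)
  have h0: "0 \<le> h x" for x by (simp add: h_def)
  define c where "c = 2 powr q' / (q' - 1)"
  define eps where "eps = 1 / (2 * c)"
  have c: "0 < c" "0 < eps" "c * eps = 1 / 2" using q' by (auto simp: c_def eps_def)
  have "X = (LINT x|lborel. \<Phi> x * h x)"
    using \<Phi>0 by (simp add: X_def h_def powr_mult_base)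
  also have "\<dots> = tree_sum N (\<lambda>k m. a k m * cube_int h k m) k m"
    unfolding \<Phi> by (rule tree_op_integral[OF h(1)])
  also have "\<dots> \<le> tree_sum N (\<lambda>k m. eps * (lam k m * (cube_int h k m / cube_vol k m) powr q')
      + eps powr (1 - q) * (lam k m * v k m powr q)) k m"
  proof (rule tree_sum_mono)
    fix k and m :: "'n \<Rightarrow> int"
    have "a k m * cube_int h k m = lam k m * ((cube_int h k m / cube_vol k m) * v k m)"
      by (simp add: a_def)
    also have "\<dots> \<le> lam k m * (eps * (cube_int h k m / cube_vol k m) powr q' + eps powr (1 - q) * v k m powr q)"
      unfolding q'_def using h0 lam v c q
      by (intro mult_left_mono young_weighted) (auto simp: cube_int_nonneg less_imp_le)
    finally show "a k m * cube_int h k m \<le> eps * (lam k m * (cube_int h k m / cube_vol k m) powr q')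
      + eps powr (1 - q) * (lam k m * v k m powr q)"
      by (simp add: algebra_simps)
  qed
  also have "\<dots> = eps * tree_sum N (\<lambda>k m. lam k m * (cube_int h k m / cube_vol k m) powr q') k m
      + eps powr (1 - q) * tree_sum N (\<lambda>k m. lam k m * v k m powr q) k m"
    by (simp only: tree_sum_add tree_sum_cmult)
  finally have 1: "X \<le> eps * tree_sum N (\<lambda>k m. lam k m * (cube_int h k m / cube_vol k m) powr q') k m
      + eps powr (1 - q) * tree_sum N (\<lambda>k m. lam k m * v k m powr q) k m" .
  have "tree_sum N (\<lambda>k m. lam k m * (cube_int h k m / cube_vol k m) powr q') k m
      \<le> c * cube_int (\<lambda>x. h x powr q') k m"
    unfolding c_def by (rule cube_int_carleson[OF q' h0 h lam packing])
  moreover have "cube_int (\<lambda>x. h x powr q') k m = X"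
    unfolding cube_int_def h_pow X_def by (simp only: supp [symmetric])
  ultimately have "eps * tree_sum N (\<lambda>k m. lam k m * (cube_int h k m / cube_vol k m) powr q') k m \<le> eps * (c * X)"
    using c by (intro mult_left_mono) auto
  moreover have "eps * (c * X) = (c * eps) * X" by simp
  ultimately have "X \<le> 2 * eps powr (1 - q) * tree_sum N (\<lambda>k m. lam k m * v k m powr q) k m"
    unfolding c(3) using 1 by linarith
  also have "2 * eps powr (1 - q) = local_const q"
    by (simp add: local_const_def eps_def c_def q'_def)
  finally show "(LINT x|lborel. \<Phi> x powr q) \<le> local_const q * tree_sum N (\<lambda>k m. lam k m * v k m powr q) k m"
    by (simp add: X_def)
qed

section \<open>Scale-by-scale bounds\<close>

lemma lborel_distr_reflect:
  fixes x :: "'a::euclidean_space"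
  shows "distr lborel borel (\<lambda>y. x - y) = lborel"
  using lborel_affine[of "-1" x] by (simp add: density_1)

text \<open>Young's inequality for \<open>u / A^(1/b)\<close> and \<open>w / B^(1/c)\<close>,
  integrated. If \<open>A\<close> or \<open>B\<close> is zero, the product vanishes almost
  everywhere. With a nonnegative integral on the left, the product need not be known to be
  integrable.\<close>

lemma holder_nn_integral:
  fixes u w :: "'a \<Rightarrow> real"
  assumes b: "1 < b" and c: "1 < c" and bc: "1 / b + 1 / c = 1"
    and [measurable]: "u \<in> borel_measurable M" "w \<in> borel_measurable M"
    and u: "\<And>x. 0 \<le> u x" and w: "\<And>x. 0 \<le> w x"
    and iu: "integrable M (\<lambda>x. u x powr b)" and iw: "integrable M (\<lambda>x. w x powr c)"
  shows "(\<integral>\<^sup>+ x. ennreal (u x * w x) \<partial>M)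
    \<le> ennreal ((LINT x|M. u x powr b) powr (1 / b) * (LINT x|M. w x powr c) powr (1 / c))"
proof -
  define A where "A = (LINT x|M. u x powr b)"
  define B where "B = (LINT x|M. w x powr c)"
  have AB: "0 \<le> A" "0 \<le> B" by (simp_all add: A_def B_def)
  show ?thesis
  proof (cases "A = 0 \<or> B = 0")
    case True
    then have "(AE x in M. u x powr b = 0) \<or> (AE x in M. w x powr c = 0)"
      using integral_nonneg_eq_0_iff_AE[OF iu] integral_nonneg_eq_0_iff_AE[OF iw] by (simp add: A_def B_def)
    then have "AE x in M. ennreal (u x * w x) = 0"
      by (auto elim: eventually_mono)
    then have "(\<integral>\<^sup>+ x. ennreal (u x * w x) \<partial>M) = 0"
      by (simp add: nn_integral_0_iff_AE)
    then show ?thesis by simp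
  next
    case False
    with AB have pos: "0 < A" "0 < B" by auto
    define K where "K = A powr (1 / b) * B powr (1 / c)"
    have K: "0 < K" using pos by (simp add: K_def)
    have le: "u x * w x \<le> K / (b * A) * u x powr b + K / (c * B) * w x powr c" for x
    proof -
      have "(u x / A powr (1 / b)) * (w x / B powr (1 / c))
          \<le> (u x / A powr (1 / b)) powr b / b + (w x / B powr (1 / c)) powr c / c"
        using b c bc u w pos by (intro Youngs_inequality) auto
      also have "\<dots> = u x powr b / (b * A) + w x powr c / (c * B)"
        using b c pos u w by (simp add: powr_divide powr_powr mult.commute)
      finally have "(u x / A powr (1 / b)) * (w x / B powr (1 / c)) * K \<le> (u x powr b / (b * A) + w x powr c / (c * B)) * K"
        using K by (intro mult_right_mono) auto
      also have "(u x / A powr (1 / b)) * (w x / B powr (1 / c)) * K = u x * w x"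
        using pos by (simp add: K_def)
      finally show ?thesis by (simp add: algebra_simps)
    qed
    have int: "integrable M (\<lambda>x. K / (b * A) * u x powr b + K / (c * B) * w x powr c)"
      using iu iw by simp
    have "(\<integral>\<^sup>+ x. ennreal (u x * w x) \<partial>M) \<le> (\<integral>\<^sup>+ x. ennreal (K / (b * A) * u x powr b + K / (c * B) * w x powr c) \<partial>M)"
      by (intro nn_integral_mono ennreal_leI le)
    also have "\<dots> = ennreal (LINT x|M. K / (b * A) * u x powr b + K / (c * B) * w x powr c)"
      using K pos b c by (intro nn_integral_eq_integral int AE_I2) auto
    also have "(LINT x|M. K / (b * A) * u x powr b + K / (c * B) * w x powr c) = K / (b * A) * A + K / (c * B) * B"
      using iu iw by (simp add: A_def B_def)
    also have "\<dots> = K * (1 / b + 1 / c)" using pos by (simp add: field_simps)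
    finally show ?thesis by (simp add: bc K_def A_def B_def)
  qed
qed

text \<open>Both \<open>y \<mapsto> x - y\<close> and \<open>y \<mapsto> x + y\<close> preserve
  Lebesgue measure, so Hoelder in \<open>y\<close> decouples \<open>f\<close> from \<open>g\<close>
  and removes \<open>x\<close> from the bound.\<close>

lemma holder_dyadic_cubes:
  fixes f g :: "real^'n::finite \<Rightarrow> real"
  assumes b: "1 < b" and c: "1 < c" and bc: "1 / b + 1 / c = 1"
    and [measurable]: "f \<in> borel_measurable borel" "g \<in> borel_measurable borel"
    and f: "\<And>x. 0 \<le> f x" and g: "\<And>x. 0 \<le> g x"
    and lf: "locally_integrable (\<lambda>x. f x powr b)" and lg: "locally_integrable (\<lambda>x. g x powr c)"
  shows "(\<integral>\<^sup>+ y. ennreal ((indicator (dyadic_cube k m) (x - y) * f (x - y))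
        * (indicator (dyadic_cube k m') (x + y) * g (x + y))) \<partial>lborel)
    \<le> ennreal (cube_int (\<lambda>x. f x powr b) k m powr (1 / b) * cube_int (\<lambda>x. g x powr c) k m' powr (1 / c))"
proof -
  define F where "F = (\<lambda>z. indicator (dyadic_cube k m) z * f z powr b)"
  define G where "G = (\<lambda>z. indicator (dyadic_cube k m') z * g z powr c)"
  have FG: "F \<in> borel_measurable borel" "G \<in> borel_measurable borel"
    by (simp_all add: F_def G_def)
  have int: "integrable (distr lborel borel (\<lambda>y. x - y)) F" "integrable (distr lborel borel (\<lambda>y. x + y)) G"
    using lf lg unfolding lborel_distr_reflect lborel_distr_plus
    by (auto simp: F_def G_def locally_integrable_def)
  have iF: "integrable lborel (\<lambda>y. F (x - y))"
    using int(1) by (rule integrable_distr[rotated]) simp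
  have iG: "integrable lborel (\<lambda>y. G (x + y))"
    using int(2) by (rule integrable_distr[rotated]) simp
  have eF: "(LINT y|lborel. F (x - y)) = (LINT z|lborel. F z)"
    using integral_distr[of "\<lambda>y. x - y" lborel borel F] FG lborel_distr_reflect[of x] by simp
  have eG: "(LINT y|lborel. G (x + y)) = (LINT z|lborel. G z)"
    using integral_distr[of "\<lambda>y. x + y" lborel borel G] FG lborel_distr_plus[of x] by simp
  have pF: "(indicator (dyadic_cube k m) z * f z) powr b = F z"
    and pG: "(indicator (dyadic_cube k m') z * g z) powr c = G z" for z
    using b c by (auto simp: F_def G_def indicator_def)
  have "(\<integral>\<^sup>+ y. ennreal ((indicator (dyadic_cube k m) (x - y) * f (x - y))
        * (indicator (dyadic_cube k m') (x + y) * g (x + y))) \<partial>lborel)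
     \<le> ennreal ((LINT y|lborel. (indicator (dyadic_cube k m) (x - y) * f (x - y)) powr b) powr (1 / b)
        * (LINT y|lborel. (indicator (dyadic_cube k m') (x + y) * g (x + y)) powr c) powr (1 / c))"
    using iF iG f g by (intro holder_nn_integral b c bc) (simp_all add: pF pG)
  then show ?thesis
    unfolding pF pG eF eG by (simp add: F_def G_def cube_int_def)
qed

lemma cube_index_shift:
  assumes "\<bar>y $ i\<bar> \<le> 2 powr real_of_int k"
  shows "\<bar>cube_index k (x + y) i - cube_index k x i\<bar> \<le> 1"
proof -
  have "\<bar>y $ i / 2 powr real_of_int k\<bar> \<le> 1"
    using assms by (simp add: abs_divide)
  then show ?thesis
    unfolding cube_index_def vector_add_component add_divide_distrib by linarith
qed

lemma shifted_cube_cover: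
  fixes x y :: "real^'n::finite"
  assumes "norm y \<le> 2 powr real_of_int k"
  obtains e where "e \<in> shifts 1" "x + y \<in> dyadic_cube k (\<lambda>i. cube_index k x i + e i)"
proof
  show "(\<lambda>i. cube_index k (x + y) i - cube_index k x i) \<in> shifts 1"
    using cube_index_shift[of y _ k x] component_le_norm_cart[of y] assms
    by (auto simp: shifts_def intro: order_trans)
  show "x + y \<in> dyadic_cube k (\<lambda>i. cube_index k x i + (cube_index k (x + y) i - cube_index k x i))"
    by (simp add: mem_dyadic_cube_iff)
qed

lemma le_sum_shifted_cubes:
  fixes x y :: "real^'n::finite" and t :: real
  assumes "norm y \<le> 2 powr real_of_int k" "0 \<le> t"
  shows "t \<le> (\<Sum>e\<in>shifts 1. indicator (dyadic_cube k (\<lambda>i. cube_index k x i + e i)) (x + y) * t)"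
proof -
  obtain e where e: "e \<in> shifts 1" "x + y \<in> dyadic_cube k (\<lambda>i. cube_index k x i + e i)"
    using shifted_cube_cover[OF assms(1)] .
  then have "t = indicator (dyadic_cube k (\<lambda>i. cube_index k x i + e i)) (x + y) * t" by simp
  also have "\<dots> \<le> (\<Sum>e\<in>shifts 1. indicator (dyadic_cube k (\<lambda>i. cube_index k x i + e i)) (x + y) * t)"
    using assms(2) e(1) by (intro member_le_sum) auto
  finally show ?thesis .
qed

text \<open>Kernel size at distance \<open>2^k\<close> times the Hoelder bound. Since
  \<open>1/b + 1/c = 1\<close>, this is \<open>|R|^(\<alpha>/n) <f^b>^(1/b) <g^c>^(1/c)\<close> with
  averages over the neighbours \<open>e\<close> and \<open>e'\<close> of \<open>R\<close>.\<close>

definition pair_coeff :: "real \<Rightarrow> real \<Rightarrow> real \<Rightarrow> (int \<Rightarrow> ('n::finite \<Rightarrow> int) \<Rightarrow> real) \<Rightarrow> (int \<Rightarrow> ('n \<Rightarrow> int) \<Rightarrow> real)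
    \<Rightarrow> ('n \<Rightarrow> int) \<Rightarrow> ('n \<Rightarrow> int) \<Rightarrow> int \<Rightarrow> ('n \<Rightarrow> int) \<Rightarrow> real" where
  "pair_coeff \<alpha> b c U W e e' k m = 2 powr (real_of_int k * (\<alpha> - real CARD('n)))
     * U k (\<lambda>i. m i + e i) powr (1 / b) * W k (\<lambda>i. m i + e' i) powr (1 / c)"

text \<open>For \<open>|y| \<le> 2^k\<close> the points \<open>x - y\<close> and
  \<open>x + y\<close> lie in neighbours of the cube of \<open>x\<close>, chosen independently,
  hence the double sum. Integrating over the whole ball instead of an annulus is harmless for an
  upper bound on nonnegative functions.\<close>

lemma ball_integral_le:
  fixes f g :: "real^'n::finite \<Rightarrow> real"
  assumes b: "1 < b" and c: "1 < c" and bc: "1 / b + 1 / c = 1"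
    and [measurable]: "f \<in> borel_measurable borel" "g \<in> borel_measurable borel"
    and f: "\<And>x. 0 \<le> f x" and g: "\<And>x. 0 \<le> g x"
    and lf: "locally_integrable (\<lambda>x. f x powr b)" and lg: "locally_integrable (\<lambda>x. g x powr c)"
  shows "(\<integral>\<^sup>+ y. ennreal (2 powr (real_of_int k * (\<alpha> - real CARD('n))))
        * (ennreal (f (x - y) * g (x + y)) * indicator {y. norm y \<le> 2 powr real_of_int k} y) \<partial>lborel)
    \<le> ennreal (\<Sum>e\<in>shifts 1. \<Sum>e'\<in>shifts 1.
        pair_coeff \<alpha> b c (cube_int (\<lambda>x. f x powr b)) (cube_int (\<lambda>x. g x powr c)) e e' k (cube_index k x))"
proof -
  define D where "D = (\<lambda>e. dyadic_cube k (\<lambda>i. cube_index k x i + e i))"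
  have [measurable]: "D e \<in> sets borel" for e by (simp add: D_def)
  define p where "p = (\<lambda>e e' y. (indicator (D e) (x - y) * f (x - y)) * (indicator (D e') (x + y) * g (x + y)))"
  have [measurable]: "p e e' \<in> borel_measurable borel" for e e' unfolding p_def by measurable
  have p0: "0 \<le> p e e' y" for e e' y using f g by (simp add: p_def)
  let ?c = "2 powr (real_of_int k * (\<alpha> - real CARD('n)))"
  let ?q = "\<lambda>e e'. cube_int (\<lambda>x. f x powr b) k (\<lambda>i. cube_index k x i + e i) powr (1 / b)
      * cube_int (\<lambda>x. g x powr c) k (\<lambda>i. cube_index k x i + e' i) powr (1 / c)"
  have le: "ennreal (f (x - y) * g (x + y)) * indicator {y. norm y \<le> 2 powr real_of_int k} y
      \<le> (\<Sum>e\<in>shifts 1. \<Sum>e'\<in>shifts 1. ennreal (p e e' y))" for y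
  proof (cases "norm y \<le> 2 powr real_of_int k")
    case True
    have "f (x - y) \<le> (\<Sum>e\<in>shifts 1. indicator (D e) (x - y) * f (x - y))"
      using le_sum_shifted_cubes[of "- y" k "f (x - y)" x] True f by (simp add: D_def)
    moreover have "g (x + y) \<le> (\<Sum>e\<in>shifts 1. indicator (D e) (x + y) * g (x + y))"
      using le_sum_shifted_cubes[of y k "g (x + y)" x] True g by (simp add: D_def)
    ultimately have "f (x - y) * g (x + y) \<le> (\<Sum>e\<in>shifts 1. indicator (D e) (x - y) * f (x - y))
        * (\<Sum>e\<in>shifts 1. indicator (D e) (x + y) * g (x + y))"
      using f g by (intro mult_mono sum_nonneg) auto
    also have "\<dots> = (\<Sum>e\<in>shifts 1. \<Sum>e'\<in>shifts 1. p e e' y)"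
      unfolding p_def by (rule sum_product)
    finally have "ennreal (f (x - y) * g (x + y)) \<le> ennreal (\<Sum>e\<in>shifts 1. \<Sum>e'\<in>shifts 1. p e e' y)"
      by (rule ennreal_leI)
    also have "\<dots> = (\<Sum>e\<in>shifts 1. \<Sum>e'\<in>shifts 1. ennreal (p e e' y))"
      using p0 by (simp add: sum_ennreal sum_nonneg)
    finally show ?thesis using True by simp
  qed simp
  have "(\<integral>\<^sup>+ y. ennreal ?c * (ennreal (f (x - y) * g (x + y)) * indicator {y. norm y \<le> 2 powr real_of_int k} y) \<partial>lborel)
      \<le> (\<integral>\<^sup>+ y. ennreal ?c * (\<Sum>e\<in>shifts 1. \<Sum>e'\<in>shifts 1. ennreal (p e e' y)) \<partial>lborel)"
    by (intro nn_integral_mono mult_left_mono le) simp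
  also have "\<dots> = ennreal ?c * (\<Sum>e\<in>shifts 1. \<Sum>e'\<in>shifts 1. (\<integral>\<^sup>+ y. ennreal (p e e' y) \<partial>lborel))"
    by (simp add: nn_integral_cmult nn_integral_sum)
  also have "\<dots> \<le> ennreal ?c * (\<Sum>e\<in>shifts 1. \<Sum>e'\<in>shifts 1. ennreal (?q e e'))"
    unfolding p_def D_def
    by (intro mult_left_mono sum_mono holder_dyadic_cubes b c bc f g lf lg) simp_all
  also have "\<dots> = ennreal (?c * (\<Sum>e\<in>shifts 1. \<Sum>e'\<in>shifts 1. ?q e e'))"
    by (simp add: sum_ennreal sum_nonneg flip: ennreal_mult)
  also have "?c * (\<Sum>e\<in>shifts 1. \<Sum>e'\<in>shifts 1. ?q e e') = (\<Sum>e\<in>shifts 1. \<Sum>e'\<in>shifts 1.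
        pair_coeff \<alpha> b c (cube_int (\<lambda>x. f x powr b)) (cube_int (\<lambda>x. g x powr c)) e e' k (cube_index k x))"
    by (simp add: pair_coeff_def sum_distrib_left mult.assoc)
  finally show ?thesis .
qed

section \<open>Normalised pairs\<close>

lemma enn_powr_ennreal: "0 \<le> x \<Longrightarrow> enn_powr (ennreal x) r = ennreal (x powr r)"
  by (simp add: enn_powr_def)

lemma enn_powr_top [simp]: "enn_powr top r = top"
  by (simp add: enn_powr_def)

lemma enn_powr_mono: "0 \<le> r \<Longrightarrow> x \<le> y \<Longrightarrow> enn_powr x r \<le> enn_powr y r"
  by (cases x; cases y) (auto simp: enn_powr_ennreal powr_mono2 top_unique intro!: ennreal_leI)

lemma enn_powr_powr: "0 < r \<Longrightarrow> 0 < s \<Longrightarrow> enn_powr (enn_powr x r) s = enn_powr x (r * s)"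
  by (cases x) (simp_all add: enn_powr_ennreal powr_powr)

lemma enn_powr_1 [simp]: "enn_powr x 1 = x"
  by (cases x) (simp_all add: enn_powr_ennreal)

lemma enn_powr_cmult: "0 < c \<Longrightarrow> enn_powr (ennreal c * x) r = ennreal (c powr r) * enn_powr x r"
  by (cases x) (simp_all add: enn_powr_ennreal powr_mult ennreal_mult_top flip: ennreal_mult)

text \<open>Raising to \<open>1 / r\<close> inverts the power monotonically, which moves it past the
  supremum without a continuity argument.\<close>

lemma enn_powr_le_SUP:
  assumes r: "0 < r" and x: "x \<le> (SUP N. a N)"
  shows "enn_powr x r \<le> (SUP N. enn_powr (a N) r)"
proof -
  let ?s = "SUP N. enn_powr (a N) r"
  have "a N \<le> enn_powr ?s (1 / r)" for N
  proof -
    have "enn_powr (a N) r \<le> ?s" by (rule SUP_upper) simp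
    from enn_powr_mono[OF _ this, of "1 / r"] r show ?thesis by (simp add: enn_powr_powr)
  qed
  then have "x \<le> enn_powr ?s (1 / r)"
    using x by (intro order_trans[OF x] SUP_least)
  from enn_powr_mono[OF _ this, of r] r show ?thesis by (simp add: enn_powr_powr)
qed

text \<open>The single scale \<open>K\<close> with \<open>2^(K-1) \<le> |y| \<le> 2^K\<close>
  already suffices; the factor \<open>2^d\<close> pays for passing between the two endpoints. The
  series is split at \<open>k0\<close> because smaller and larger scales are estimated
  differently.\<close>

lemma kernel_le_dyadic_sum:
  fixes y :: "'a::real_normed_vector"
  assumes "0 \<le> F" "d \<ge> 0"
  defines "s \<equiv> \<lambda>k. ennreal (2 powr d) * (ennreal (2 powr (real_of_int k * (- d)))
      * (ennreal F * indicator {y. norm y \<le> 2 powr real_of_int k} y))"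
  shows "ennreal (F / norm y powr d) \<le> (\<Sum>j. s (k0 - int j)) + (\<Sum>j. s (k0 + 1 + int j))"
\<comment> \<open>At \<open>y = 0\<close> the left side is 0, since \<open>0 powr d = 0\<close> and
  division by zero gives 0.\<close>
proof (cases "y = 0")
  case False
  define K where "K = \<lfloor>log 2 (norm y)\<rfloor> + 1"
  have log: "real_of_int (K - 1) \<le> log 2 (norm y)" "log 2 (norm y) \<le> real_of_int K"
    unfolding K_def by linarith+
  have y: "2 powr real_of_int (K - 1) \<le> norm y" "norm y \<le> 2 powr real_of_int K"
    using log False le_log_iff[of 2 "norm y"] log_le_iff[of 2 "norm y"] by auto
  have "(2 powr real_of_int (K - 1)) powr d \<le> norm y powr d"
    using y assms(2) by (intro powr_mono2) auto
  then have "F / norm y powr d \<le> F / (2 powr real_of_int (K - 1)) powr d"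
    using assms(1) False by (intro divide_left_mono) auto
  also have "\<dots> = 2 powr d * (2 powr (real_of_int K * (- d)) * F)"
  proof -
    have "d + real_of_int K * (- d) = - (real_of_int (K - 1) * d)" by (simp add: algebra_simps)
    then have "2 powr d * 2 powr (real_of_int K * (- d)) = (1::real) / (2 powr real_of_int (K - 1)) powr d"
      by (simp only: powr_add [symmetric] powr_minus_divide powr_powr)
    then show ?thesis by (simp only: mult.assoc [symmetric]) simp
  qed
  finally have "ennreal (F / norm y powr d) \<le> s K"
    using y(2) assms(1) by (simp add: s_def ennreal_leI flip: ennreal_mult)
  also have "s K \<le> (\<Sum>j. s (k0 - int j)) + (\<Sum>j. s (k0 + 1 + int j))"
  proof -
    have single: "h j \<le> (\<Sum>j. h j)" for h :: "nat \<Rightarrow> ennreal" and j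
      using sum_le_suminf[of h "{j}"] by simp
    show ?thesis
    proof (cases "K \<le> k0")
      case True
      then show ?thesis
        using single[of "\<lambda>j. s (k0 - int j)" "nat (k0 - K)"] by (simp add: add_increasing2)
    next
      case False
      then show ?thesis
        using single[of "\<lambda>j. s (k0 + 1 + int j)" "nat (K - k0 - 1)"] by (simp add: add_increasing)
    qed
  qed
  finally show ?thesis .
qed simp

text \<open>Here \<open>b\<close>, \<open>p\<close>, \<open>q\<close> stand for \<open>q1\<close>,
  \<open>p2\<close>, \<open>q2\<close>. The two Morrey bounds state norm at most 1 in integrated
  form; for \<open>f\<close>, with Morrey exponent \<open>n/\<alpha>\<close>, the bound
  \<open>|R|^(1 - b \<alpha>/n)\<close> is written in terms of the side length.\<close>

locale normalized_pair =
  fixes \<alpha> b c p q :: real and f g :: "real^'n::finite \<Rightarrow> real"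
  assumes alpha: "0 < \<alpha>" "\<alpha> < real CARD('n)" and b: "1 < b" and c: "1 < c" and bc: "1 / b + 1 / c = 1"
    and p: "0 < p" and cq: "c < q"
    and f_borel [measurable]: "f \<in> borel_measurable borel" and g_borel [measurable]: "g \<in> borel_measurable borel"
    and f_nonneg: "\<And>x. 0 \<le> f x" and g_nonneg: "\<And>x. 0 \<le> g x"
    and f_int: "locally_integrable (\<lambda>x. f x powr b)" and g_int: "locally_integrable (\<lambda>x. g x powr q)"
    and f_morrey: "\<And>k m. cube_int (\<lambda>x. f x powr b) k m \<le> 2 powr (- real_of_int k * \<alpha> * b) * cube_vol k m"
    and g_morrey: "\<And>k m. cube_int (\<lambda>x. g x powr q) k m \<le> cube_vol k m powr (1 - q / p)"
begin

abbreviation "U \<equiv> cube_int (\<lambda>x. f x powr b)"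
abbreviation "W \<equiv> cube_int (\<lambda>x. g x powr c)"

lemma q: "1 < q" using c cq by simp

lemma g_int_c: "locally_integrable (\<lambda>x. g x powr c)"
  unfolding locally_integrable_def
proof (intro allI)
  fix k and m :: "'n \<Rightarrow> int"
  have le: "g x powr c \<le> 1 + g x powr q" for x
  proof (cases "g x \<le> 1")
    case True
    then have "g x powr c \<le> 1" using g_nonneg[of x] c by (intro powr_le1) auto
    then show ?thesis by (simp add: add_increasing2)
  next
    case False
    then have "g x powr c \<le> g x powr q" using cq by (intro powr_mono) auto
    then show ?thesis by simp
  qed
  show "integrable lborel (\<lambda>x. indicator (dyadic_cube k m) x * g x powr c)"
  proof (rule Bochner_Integration.integrable_bound)
    show "integrable lborel (\<lambda>x. indicator (dyadic_cube k m) x + indicator (dyadic_cube k m) x * g x powr q)"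
      using g_int by (auto simp: locally_integrable_def integrable_indicator_iff emeasure_dyadic_cube)
    show "AE x in lborel. norm (indicator (dyadic_cube k m) x * g x powr c)
        \<le> norm (indicator (dyadic_cube k m) x + indicator (dyadic_cube k m) x * g x powr q)"
      using le by (intro AE_I2) (auto simp: indicator_def)
  qed simp
qed

lemma g_powr: "(\<lambda>x. (g x powr c) powr (q / c)) = (\<lambda>x. g x powr q)"
  using c by (simp add: powr_powr)

lemma U_nonneg: "0 \<le> U k m" by (simp add: cube_int_nonneg)
lemma W_nonneg: "0 \<le> W k m" by (simp add: cube_int_nonneg)

text \<open>Jensen with exponent \<open>q / c > 1\<close> passes from the Morrey bound on
  \<open>q\<close>-averages to \<open>c\<close>-averages.\<close>

lemma W_le: "W k m powr (1 / c) \<le> cube_vol k m powr (1 / c - 1 / p)"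
proof -
  let ?V = "cube_vol k m"
  have r: "1 < q / c" using c cq by simp
  have "W k m powr (q / c) * ?V powr (1 - q / c) \<le> cube_int (\<lambda>x. (g x powr c) powr (q / c)) k m"
    by (rule cube_int_jensen[OF r _ g_int_c]) (simp_all add: g_powr g_int)
  also have "\<dots> \<le> ?V powr (1 - q / p)"
    unfolding g_powr by (rule g_morrey)
  finally have "W k m powr (q / c) * ?V powr (1 - q / c) * ?V powr (q / c - 1) \<le> ?V powr (1 - q / p) * ?V powr (q / c - 1)"
    by (intro mult_right_mono) auto
  then have "W k m powr (q / c) \<le> ?V powr (q / c - q / p)"
    by (simp add: mult.assoc powr_add [symmetric])
  then have "(W k m powr (q / c)) powr (1 / q) \<le> (?V powr (q / c - q / p)) powr (1 / q)"
    using q by (intro powr_mono2) auto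
  moreover have "(q / c - q / p) * (1 / q) = 1 / c - 1 / p"
    using q by (simp add: field_simps)
  ultimately show ?thesis
    using q by (simp add: powr_powr)
qed

section \<open>Size and packing of the coefficients; the local part\<close>

lemma pair_coeff_nonneg: "0 \<le> pair_coeff \<alpha> b c U W e e' k m"
  by (simp add: pair_coeff_def)

text \<open>The Morrey bound of \<open>f\<close> cancels \<open>2^(k \<alpha>)\<close>, and
  \<open>1/b + 1/c = 1\<close> cancels the volumes. What remains is the decay of \<open>g\<close>,
  which is summable over growing cubes.\<close>

lemma pair_coeff_le: "pair_coeff \<alpha> b c U W e e' k m \<le> cube_vol k m powr (- 1 / p)"
proof -
  let ?n = "real CARD('n)"
  have V: "cube_vol k m' = 2 powr (real_of_int k * ?n)" for m' :: "'n \<Rightarrow> int"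
    by (simp add: cube_vol_def)
  have "U k (\<lambda>i. m i + e i) powr (1 / b) \<le> (2 powr (- real_of_int k * \<alpha> * b) * 2 powr (real_of_int k * ?n)) powr (1 / b)"
    using f_morrey[of k "\<lambda>i. m i + e i"] b U_nonneg by (intro powr_mono2) (auto simp: V)
  also have "\<dots> = 2 powr (- real_of_int k * \<alpha> + real_of_int k * ?n * (1 / b))"
    using b by (simp only: powr_mult powr_powr powr_add) simp
  finally have "pair_coeff \<alpha> b c U W e e' k m \<le> 2 powr (real_of_int k * (\<alpha> - ?n))
      * 2 powr (- real_of_int k * \<alpha> + real_of_int k * ?n * (1 / b)) * 2 powr (real_of_int k * ?n * (1 / c - 1 / p))"
    using W_le[of k "\<lambda>i. m i + e' i"] unfolding pair_coeff_def V powr_powr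
    by (intro mult_mono) auto
  also have "\<dots> = 2 powr (real_of_int k * (\<alpha> - ?n) + (- real_of_int k * \<alpha> + real_of_int k * ?n * (1 / b)) + real_of_int k * ?n * (1 / c - 1 / p))"
    by (simp only: powr_add)
  also have "real_of_int k * (\<alpha> - ?n) + (- real_of_int k * \<alpha> + real_of_int k * ?n * (1 / b)) + real_of_int k * ?n * (1 / c - 1 / p)
      = real_of_int k * ?n * (1 / b + 1 / c - 1 - 1 / p)"
    by (simp add: algebra_simps)
  also have "1 / b + 1 / c - 1 - 1 / p = - 1 / p" by (simp add: bc)
  finally show ?thesis by (simp add: V powr_powr)
qed

text \<open>The constant of \<open>weight_packing\<close> for shifts up to 2, because
  \<open>pair_tree_op\<close> needs packing for differences of two shifts of size 1.\<close>

definition "\<kappa> = real (card (shifts 2 :: ('n \<Rightarrow> int) set)) powr (1 / b) / (1 - 2 powr (- \<alpha>))"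

lemma kappa_pos: "0 < \<kappa>"
  unfolding \<kappa>_def using alpha card_shifts_pos[of 2, where 'n = 'n]
  by (intro divide_pos_pos) (auto simp: powr_less_one card_gt_0_iff)

lemma weight_nonneg: "0 \<le> weight \<alpha> b e U k m"
  by (simp add: weight_def)

lemma packing:
  assumes "e \<in> shifts 2"
  shows "tree_sum N (\<lambda>k m. weight \<alpha> b e U k m / \<kappa>) k m \<le> cube_vol k m"
proof -
  have "tree_sum N (weight \<alpha> b e U) k m \<le> \<kappa> * cube_vol k m"
    unfolding \<kappa>_def using alpha b assms cube_int_sum[OF f_int] f_morrey U_nonneg
    by (intro weight_packing) auto
  then show ?thesis
    using tree_sum_cmult[of N "1 / \<kappa>" "weight \<alpha> b e U" k m] kappa_pos
    by (simp add: pos_divide_le_eq mult.commute)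
qed

text \<open>In order: the duality constant, the normalisation of the weights, the number of
  neighbouring trees, and the embedding constant for exponent \<open>q / c\<close>.\<close>

definition "local_bound = local_const q * (\<kappa> powr q * (real (card (shifts 1 :: ('n \<Rightarrow> int) set))
    * (2 powr (q / c) / (q / c - 1))))"

lemma local_const_nonneg: "0 \<le> local_const q" by (simp add: local_const_def)

lemma local_bound_nonneg: "0 \<le> local_bound"
  using local_const_nonneg c cq unfolding local_bound_def by (intro mult_nonneg_nonneg divide_nonneg_nonneg) auto

text \<open>By \<open>1 - 1/b = 1/c\<close> the coefficient factors into a normalised packing weight
  over \<open>|R|\<close>, carrying \<open>f\<close>, and a value carrying \<open>g\<close>: the
  shape required by \<open>tree_op_powr_integral\<close>.\<close>

lemma pair_coeff_eq:
  "pair_coeff \<alpha> b c U W e e' k m = (weight \<alpha> b e U k m / \<kappa>) / cube_vol k m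
      * (\<kappa> * (W k (\<lambda>i. m i + e' i) / cube_vol k m) powr (1 / c))"
proof -
  let ?n = "real CARD('n)" and ?V = "cube_vol k m"
  have "1 - 1 / b = 1 / c" using bc by simp
  then have "?V powr (1 - 1 / b) = ?V powr (1 / c)" by simp
  moreover have "2 powr (real_of_int k * (\<alpha> - ?n)) = 2 powr (real_of_int k * \<alpha>) / ?V"
    by (simp add: cube_vol_def powr_diff right_diff_distrib)
  ultimately show ?thesis
    using kappa_pos W_nonneg by (simp add: pair_coeff_def weight_def powr_divide less_imp_le)
qed

text \<open>Carleson embedding is used twice: inside \<open>tree_op_powr_integral\<close> on the
  dual function, and here on \<open>g^c\<close> with exponent \<open>q / c\<close>, which bounds the
  remaining weighted sum by integrals of \<open>g^q\<close>.\<close>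

lemma pair_tree_op:
  fixes N :: nat and k :: int and m :: "'n \<Rightarrow> int"
  assumes e: "e \<in> shifts 1" "e' \<in> shifts 1"
  defines "\<Phi> \<equiv> tree_op N (pair_coeff \<alpha> b c U W e e') k m"
  shows "integrable lborel (\<lambda>x. \<Phi> x powr q)"
    and "(LINT x|lborel. \<Phi> x powr q) \<le> local_bound * cube_vol k m powr (1 - q / p)"
proof -
  define r where "r = q / c"
  have r: "1 < r" using c cq by (simp add: r_def)
  define lam where "lam = (\<lambda>e k m. weight \<alpha> b e U k m / \<kappa>)"
  have lam: "0 \<le> lam e k m" for e k m
    using kappa_pos weight_nonneg by (simp add: lam_def)
  define v where "v = (\<lambda>k m. \<kappa> * (W k (\<lambda>i. m i + e' i) / cube_vol k m) powr (1 / c))"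
  have v: "0 \<le> v k m" for k m using kappa_pos by (simp add: v_def)
  have \<Phi>: "\<Phi> = tree_op N (\<lambda>k m. lam e k m / cube_vol k m * v k m) k m"
    unfolding \<Phi>_def lam_def v_def
    by (rule arg_cong[where f = "\<lambda>a. tree_op N a k m"]) (intro ext pair_coeff_eq)
  have e2: "e \<in> shifts 2" "(\<lambda>i. e i - e' i) \<in> shifts 2"
  proof -
    have *: "\<bar>e i\<bar> \<le> 1" "\<bar>e' i\<bar> \<le> 1" for i using e by (auto simp: shifts_def)
    have "\<bar>e i\<bar> \<le> 2" "\<bar>e i - e' i\<bar> \<le> 2" for i using *[of i] by linarith+
    then show "e \<in> shifts 2" "(\<lambda>i. e i - e' i) \<in> shifts 2" by (auto simp: shifts_def)
  qed
  have pack: "tree_sum N (lam e) k m \<le> cube_vol k m" if "e \<in> shifts 2" for e N k m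
    unfolding lam_def by (rule packing[OF that])
  show "integrable lborel (\<lambda>x. \<Phi> x powr q)"
    unfolding \<Phi> by (rule tree_op_powr_integral[OF q lam v pack[OF e2(1)]])
  have "(LINT x|lborel. \<Phi> x powr q) \<le> local_const q * tree_sum N (\<lambda>k m. lam e k m * v k m powr q) k m"
    unfolding \<Phi> by (rule tree_op_powr_integral[OF q lam v pack[OF e2(1)]])
  also have "\<dots> \<le> local_const q * (\<kappa> powr q * (real (card (shifts 1 :: ('n \<Rightarrow> int) set))
      * (2 powr r / (r - 1)) * cube_vol k m powr (1 - q / p)))"
  proof (rule mult_left_mono[OF _ local_const_nonneg])
    define F where "F = (\<lambda>k m. lam (\<lambda>i. e i - e' i) k m * (W k m / cube_vol k m) powr r)"
    have F0: "0 \<le> F k m" for k m using lam by (simp add: F_def)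
    \<comment> \<open>Re-centring at the cube of \<open>g\<close>: the weight at \<open>R\<close>
      with shift \<open>e\<close> is the weight at \<open>R + e'\<close> with shift
      \<open>e - e'\<close>. Weight and average then belong to the same cube.\<close>
    have eq: "lam e k m * v k m powr q = \<kappa> powr q * F k (\<lambda>i. m i + e' i)" for k and m :: "'n \<Rightarrow> int"
    proof -
      have "v k m powr q = \<kappa> powr q * (W k (\<lambda>i. m i + e' i) / cube_vol k m) powr r"
        using kappa_pos W_nonneg by (simp add: v_def r_def powr_mult powr_powr)
      moreover have "lam (\<lambda>i. e i - e' i) k (\<lambda>i. m i + e' i) = lam e k m"
        by (simp add: lam_def weight_def cube_vol_def algebra_simps)
      ultimately show ?thesis by (simp add: F_def cube_vol_def)
    qed
    have "tree_sum N (\<lambda>k m. lam e k m * v k m powr q) k m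
        = \<kappa> powr q * tree_sum N (\<lambda>k m. F k (\<lambda>i. m i + e' i)) k m"
      unfolding eq by (rule tree_sum_cmult)
    also have "\<dots> \<le> \<kappa> powr q * (\<Sum>d\<in>shifts 1. tree_sum N F k (\<lambda>i. m i + d i))"
      by (intro mult_left_mono tree_sum_shift_le e F0) simp
    also have "\<dots> \<le> \<kappa> powr q * (\<Sum>d\<in>(shifts 1 :: ('n \<Rightarrow> int) set). 2 powr r / (r - 1) * cube_vol k m powr (1 - q / p))"
    proof (intro mult_left_mono sum_mono)
      fix d :: "'n \<Rightarrow> int"
      have "tree_sum N F k (\<lambda>i. m i + d i) \<le> 2 powr r / (r - 1) * cube_int (\<lambda>x. (g x powr c) powr r) k (\<lambda>i. m i + d i)"
        unfolding F_def
        by (rule cube_int_carleson[OF r _ g_int_c _ lam pack[OF e2(2)]]) (simp_all add: r_def g_powr g_int)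
      also have "\<dots> \<le> 2 powr r / (r - 1) * cube_vol k m powr (1 - q / p)"
        using g_morrey[of k "\<lambda>i. m i + d i"] r unfolding r_def g_powr
        by (intro mult_left_mono) (auto simp: cube_vol_def)
      finally show "tree_sum N F k (\<lambda>i. m i + d i) \<le> 2 powr r / (r - 1) * cube_vol k m powr (1 - q / p)" .
    qed simp
    finally show "tree_sum N (\<lambda>k m. lam e k m * v k m powr q) k m
      \<le> \<kappa> powr q * (real (card (shifts 1 :: ('n \<Rightarrow> int) set)) * (2 powr r / (r - 1)) * cube_vol k m powr (1 - q / p))"
      by (simp add: mult.assoc)
  qed
  finally show "(LINT x|lborel. \<Phi> x powr q) \<le> local_bound * cube_vol k m powr (1 - q / p)"
    by (simp add: local_bound_def r_def mult.assoc)
qed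

section \<open>Large scales and the estimate on a fixed cube\<close>

abbreviation "P \<equiv> (shifts 1 \<times> shifts 1 :: (('n \<Rightarrow> int) \<times> ('n \<Rightarrow> int)) set)"

abbreviation "scale_sum k m \<equiv> (\<Sum>s\<in>P. pair_coeff \<alpha> b c U W (fst s) (snd s) k m)"

text \<open>Sum of the geometric series of ratio \<open>2^(-n/p)\<close> by which
  \<open>pair_coeff_le\<close> decays from one generation to the next larger one.\<close>

definition "\<gamma> = 1 / (1 - 2 powr (- real CARD('n) / p))"

lemma gamma_pos: "0 < \<gamma>"
  using p unfolding \<gamma>_def by (intro divide_pos_pos) (auto simp: powr_less_one divide_neg_pos)

lemma bilinear_le:
  "bilinear_frac_int \<alpha> f g x
    \<le> ennreal (2 powr (real CARD('n) - \<alpha>)) * ((\<Sum>j. ennreal (scale_sum (k - int j) (cube_index (k - int j) x)))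
        + (\<Sum>j. ennreal (scale_sum (k + 1 + int j) (cube_index (k + 1 + int j) x))))"
proof -
  let ?d = "real CARD('n) - \<alpha>"
  define s where "s = (\<lambda>k y. ennreal (2 powr ?d) * (ennreal (2 powr (real_of_int k * (- ?d)))
      * (ennreal (f (x - y) * g (x + y)) * indicator {y. norm y \<le> 2 powr real_of_int k} y)))"
  have [measurable]: "s k \<in> borel_measurable borel" for k
    unfolding s_def by measurable
  have int_s: "(\<integral>\<^sup>+ y. s k y \<partial>lborel) \<le> ennreal (2 powr ?d) * ennreal (scale_sum k (cube_index k x))" for k
  proof -
    have "(\<integral>\<^sup>+ y. s k y \<partial>lborel) = ennreal (2 powr ?d) * (\<integral>\<^sup>+ y. (ennreal (2 powr (real_of_int k * (\<alpha> - real CARD('n))))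
      * (ennreal (f (x - y) * g (x + y)) * indicator {y. norm y \<le> 2 powr real_of_int k} y)) \<partial>lborel)"
      unfolding s_def by (subst nn_integral_cmult) auto
    also have "\<dots> \<le> ennreal (2 powr ?d) * ennreal (scale_sum k (cube_index k x))"
      using ball_integral_le[OF b c bc f_borel g_borel f_nonneg g_nonneg f_int g_int_c, of k \<alpha> x]
      by (intro mult_left_mono) (simp_all add: sum.cartesian_product case_prod_beta)
    finally show ?thesis .
  qed
  have "bilinear_frac_int \<alpha> f g x = (\<integral>\<^sup>+ y. ennreal (f (x - y) * g (x + y) / norm y powr ?d) \<partial>lborel)"
    by (simp add: bilinear_frac_int_def nn_integral_completion)
  also have "\<dots> \<le> (\<integral>\<^sup>+ y. (\<Sum>j. s (k - int j) y) + (\<Sum>j. s (k + 1 + int j) y) \<partial>lborel)"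
    unfolding s_def using alpha f_nonneg g_nonneg by (intro nn_integral_mono kernel_le_dyadic_sum) auto
  also have "\<dots> = (\<Sum>j. \<integral>\<^sup>+ y. s (k - int j) y \<partial>lborel) + (\<Sum>j. \<integral>\<^sup>+ y. s (k + 1 + int j) y \<partial>lborel)"
    by (simp add: nn_integral_add nn_integral_suminf)
  also have "\<dots> \<le> (\<Sum>j. ennreal (2 powr ?d) * ennreal (scale_sum (k - int j) (cube_index (k - int j) x)))
      + (\<Sum>j. ennreal (2 powr ?d) * ennreal (scale_sum (k + 1 + int j) (cube_index (k + 1 + int j) x)))"
    by (intro add_mono suminf_le int_s summableI)
  also have "\<dots> = ennreal (2 powr ?d) * ((\<Sum>j. ennreal (scale_sum (k - int j) (cube_index (k - int j) x)))
        + (\<Sum>j. ennreal (scale_sum (k + 1 + int j) (cube_index (k + 1 + int j) x))))"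
    by (simp add: ennreal_suminf_cmult distrib_left)
  finally show ?thesis .
qed

lemma scale_sum_le: "scale_sum k m \<le> real (card P) * cube_vol k m powr (- 1 / p)"
  by (rule order_trans[OF sum_mono[OF pair_coeff_le]]) simp

lemma large_scales_le:
  fixes m :: "'n \<Rightarrow> int"
  shows "(\<Sum>j. ennreal (scale_sum (k + 1 + int j) (cube_index (k + 1 + int j) x)))
    \<le> ennreal (real (card P) * \<gamma> * cube_vol k m powr (- 1 / p))"
proof -
  define t where "t = 2 powr (- real CARD('n) / p)"
  have t: "0 < t" "t < 1" using p by (auto simp: t_def powr_less_one divide_neg_pos)
  define A where "A = real (card P) * cube_vol k m powr (- 1 / p)"
  have A: "0 \<le> A" by (simp add: A_def)
  have le: "scale_sum (k + 1 + int j) m' \<le> A * t ^ j" for j m'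
  proof -
    have "cube_vol (k + 1 + int j) m' powr (- 1 / p) = cube_vol k m powr (- 1 / p) * t * t ^ j"
      by (simp add: cube_vol_def t_def powr_powr powr_add [symmetric] powr_realpow [symmetric] algebra_simps add_divide_distrib diff_divide_distrib)
    \<comment> \<open>The series starts at generation \<open>k + 1\<close>, so an extra factor
      \<open>t < 1\<close> appears and is discarded.\<close>
    also have "\<dots> \<le> cube_vol k m powr (- 1 / p) * 1 * t ^ j"
      using t by (intro mult_right_mono mult_left_mono) auto
    finally have "real (card P) * cube_vol (k + 1 + int j) m' powr (- 1 / p) \<le> A * t ^ j"
      unfolding A_def mult.assoc by (intro mult_left_mono) auto
    then show ?thesis using scale_sum_le[of "k + 1 + int j" m'] by linarith
  qed
  have "(\<Sum>j. ennreal (scale_sum (k + 1 + int j) (cube_index (k + 1 + int j) x))) \<le> (\<Sum>j. ennreal (A * t ^ j))"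
    by (intro suminf_le summableI ennreal_leI le)
  also have "\<dots> = ennreal (\<Sum>j. A * t ^ j)"
    using t A by (intro suminf_ennreal2 summable_mult summable_geometric) auto
  also have "(\<Sum>j. A * t ^ j) = A * \<gamma>"
    using t by (subst suminf_mult) (auto simp: suminf_geometric \<gamma>_def t_def intro!: summable_geometric)
  finally show ?thesis by (simp add: A_def mult_ac)
qed

definition "\<Psi> k m N x = (\<Sum>s\<in>P. tree_op N (pair_coeff \<alpha> b c U W (fst s) (snd s)) k m x)"

lemma Psi_eq: "\<Psi> k m N x = (\<Sum>j<N. scale_sum (k - int j) (cube_index (k - int j) x)) * indicator (dyadic_cube k m) x"
  unfolding \<Psi>_def tree_op_eq sum_distrib_right [symmetric] by (subst sum.swap) simp

lemma Psi_nonneg: "0 \<le> \<Psi> k m N x"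
  unfolding \<Psi>_def by (intro sum_nonneg tree_op_nonneg pair_coeff_nonneg)

lemma Psi_measurable [measurable]: "\<Psi> k m N \<in> borel_measurable borel"
  unfolding \<Psi>_def by measurable

lemma Psi_incseq: "incseq (\<lambda>N. \<Psi> k m N x)"
  unfolding Psi_eq
  by (intro incseq_SucI mult_right_mono) (auto intro!: sum_nonneg pair_coeff_nonneg)

text \<open>On a fixed cube the large scales are bounded by a constant, and the small ones are the
  increasing limit of \<open>\<Psi>\<close>. The supremum form prepares monotone
  convergence.\<close>

lemma bilinear_le_SUP:
  assumes x: "x \<in> dyadic_cube k m"
  shows "bilinear_frac_int \<alpha> f g x \<le> (SUP N. ennreal (2 powr (real CARD('n) - \<alpha>)
    * (\<Psi> k m N x + real (card P) * \<gamma> * cube_vol k m powr (- 1 / p))))"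
proof -
  let ?c = "2 powr (real CARD('n) - \<alpha>)" and ?G = "real (card P) * \<gamma> * cube_vol k m powr (- 1 / p)"
  have G: "0 \<le> ?G" using gamma_pos by simp
  have "(\<Sum>j. ennreal (scale_sum (k - int j) (cube_index (k - int j) x))) = (SUP N. ennreal (\<Psi> k m N x))"
    using x pair_coeff_nonneg by (simp add: suminf_eq_SUP Psi_eq sum_ennreal sum_nonneg)
  then have "bilinear_frac_int \<alpha> f g x \<le> ennreal ?c * ((SUP N. ennreal (\<Psi> k m N x)) + ennreal ?G)"
    using bilinear_le[of x k] large_scales_le[of k x m]
    by (auto elim!: order_trans intro!: mult_left_mono add_left_mono)
  also have "\<dots> = (SUP N. ennreal ?c * (ennreal (\<Psi> k m N x) + ennreal ?G))"
    by (simp only: ennreal_SUP_add_left [OF UNIV_not_empty, symmetric] SUP_mult_left_ennreal)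
  also have "\<dots> = (SUP N. ennreal (?c * (\<Psi> k m N x + ?G)))"
    using G Psi_nonneg by (simp add: ennreal_mult ennreal_plus del: ennreal_plus[symmetric])
  finally show ?thesis .
qed

text \<open>The 2 comes from splitting a power of a sum, \<open>2^(n-\<alpha>)\<close> from the
  kernel, and \<open>card P\<close> from the sum over pairs of shifts; the last factor adds the
  local and the large-scale parts.\<close>

definition "total_const = (2 * 2 powr (real CARD('n) - \<alpha>) * real (card P)) powr q * (local_bound + \<gamma> powr q)"

lemma total_const_nonneg: "0 \<le> total_const"
  using local_bound_nonneg by (simp add: total_const_def)

text \<open>The bound \<open>R_int\<close> for the truncations is uniform in \<open>N\<close>, so
  monotone convergence yields it for the full operator.\<close>

lemma bilinear_cube_integral:
  "(\<integral>\<^sup>+ x\<in>dyadic_cube k m. enn_powr (bilinear_frac_int \<alpha> f g x) q \<partial>lborel)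
    \<le> ennreal (total_const * cube_vol k m powr (1 - q / p))"
proof -
  let ?D = "dyadic_cube k m" and ?V = "cube_vol k m"
  let ?c = "2 powr (real CARD('n) - \<alpha>)" and ?K = "real (card P)"
  define G where "G = ?K * \<gamma> * ?V powr (- 1 / p)"
  have G: "0 \<le> G" using gamma_pos by (simp add: G_def)
  define \<Phi> where "\<Phi> = (\<lambda>N s. tree_op N (pair_coeff \<alpha> b c U W (fst s) (snd s)) k m)"
  have \<Phi>: "0 \<le> \<Phi> N s x" for N s x unfolding \<Phi>_def by (intro tree_op_nonneg pair_coeff_nonneg)
  define R where "R = (\<lambda>N x. (?c * (\<Psi> k m N x + G)) powr q)"
  have [measurable]: "R N \<in> borel_measurable borel" for N unfolding R_def by measurable
  have R_le: "R N x \<le> (2 * ?c) powr q * (?K powr (q - 1) * (\<Sum>s\<in>P. \<Phi> N s x powr q) + G powr q)" for N x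
  proof -
    have "\<Psi> k m N x powr q \<le> ?K powr (q - 1) * (\<Sum>s\<in>P. \<Phi> N s x powr q)"
      unfolding \<Psi>_def \<Phi>_def [symmetric] using q \<Phi>
      by (intro order_trans[OF sum_powr_le]) (auto simp: \<Phi>_def intro: tree_op_nonneg pair_coeff_nonneg)
    moreover have "(\<Psi> k m N x + G) powr q \<le> (2 * max (\<Psi> k m N x) G) powr q"
      using q Psi_nonneg[of k m N x] G by (intro powr_mono2) auto
    moreover have "(2 * max (\<Psi> k m N x) G) powr q \<le> 2 powr q * (\<Psi> k m N x powr q + G powr q)"
      using Psi_nonneg[of k m N x] G by (auto simp: powr_mult max_def)
    ultimately have "(\<Psi> k m N x + G) powr q \<le> 2 powr q * (?K powr (q - 1) * (\<Sum>s\<in>P. \<Phi> N s x powr q) + G powr q)"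
      by (smt (verit) mult_left_mono powr_ge_zero)
    then have "?c powr q * (\<Psi> k m N x + G) powr q
        \<le> ?c powr q * (2 powr q * (?K powr (q - 1) * (\<Sum>s\<in>P. \<Phi> N s x powr q) + G powr q))"
      by (intro mult_left_mono) auto
    then show ?thesis
      using G Psi_nonneg[of k m N x] by (simp add: R_def powr_mult mult_ac)
  qed
  have R_int: "(\<integral>\<^sup>+ x. ennreal (R N x) * indicator ?D x \<partial>lborel) \<le> ennreal (total_const * ?V powr (1 - q / p))" for N
  proof -
    let ?H = "\<lambda>x. (2 * ?c) powr q * (?K powr (q - 1) * (\<Sum>s\<in>P. \<Phi> N s x powr q) + G powr q * indicator ?D x)"
    have loc: "integrable lborel (\<lambda>x. \<Phi> N s x powr q)"
      "(LINT x|lborel. \<Phi> N s x powr q) \<le> local_bound * ?V powr (1 - q / p)" if "s \<in> P" for s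
      using pair_tree_op[of "fst s" "snd s" N k m] that by (auto simp: \<Phi>_def)
    have ind: "integrable lborel (\<lambda>x. indicator ?D x :: real)" "(LINT x|lborel. indicator ?D x) = ?V"
      by (auto simp: integrable_indicator_iff emeasure_dyadic_cube measure_lborel_dyadic_cube)
    have "(\<integral>\<^sup>+ x. ennreal (R N x) * indicator ?D x \<partial>lborel) \<le> (\<integral>\<^sup>+ x. ennreal (?H x) \<partial>lborel)"
      using R_le by (intro nn_integral_mono) (auto simp: indicator_def intro!: ennreal_leI)
    also have "\<dots> = ennreal (LINT x|lborel. ?H x)"
      using loc ind(1) by (intro nn_integral_eq_integral AE_I2 mult_nonneg_nonneg add_nonneg_nonneg sum_nonneg) auto
    also have "(LINT x|lborel. ?H x) = (2 * ?c) powr q * (?K powr (q - 1) * (\<Sum>s\<in>P. LINT x|lborel. \<Phi> N s x powr q) + G powr q * ?V)"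
      using loc ind by simp
    also have "\<dots> \<le> (2 * ?c) powr q * (?K powr (q - 1) * (\<Sum>s\<in>P. local_bound * ?V powr (1 - q / p)) + G powr q * ?V)"
      by (intro mult_left_mono add_right_mono sum_mono loc) auto
    also have "\<dots> = (2 * ?c) powr q * (?K powr (q - 1) * ?K * local_bound * ?V powr (1 - q / p) + G powr q * ?V)"
      by simp
    also have "?K powr (q - 1) * ?K = ?K powr q"
      by (simp add: powr_mult_base mult.commute)
    also have "G powr q * ?V = ?K powr q * \<gamma> powr q * ?V powr (1 - q / p)"
    proof -
      have "(?V powr (- 1 / p)) powr q * ?V = ?V powr (1 - q / p)"
        using powr_add[of ?V "- 1 / p * q" 1] by (simp add: powr_powr)
      then show ?thesis
        unfolding G_def powr_mult by (simp only: mult.assoc)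
    qed
    also have "(2 * ?c) powr q * (?K powr q * local_bound * ?V powr (1 - q / p) + ?K powr q * \<gamma> powr q * ?V powr (1 - q / p))
        = total_const * ?V powr (1 - q / p)"
      by (simp add: total_const_def powr_mult algebra_simps)
    finally show ?thesis by (simp add: ennreal_leI)
  qed
  have "(\<integral>\<^sup>+ x\<in>?D. enn_powr (bilinear_frac_int \<alpha> f g x) q \<partial>lborel)
      \<le> (\<integral>\<^sup>+ x. (SUP N. ennreal (R N x) * indicator ?D x) \<partial>lborel)"
  proof (intro nn_integral_mono)
    fix x
    show "enn_powr (bilinear_frac_int \<alpha> f g x) q * indicator ?D x \<le> (SUP N. ennreal (R N x) * indicator ?D x)"
    proof (cases "x \<in> ?D")
      case True
      have "enn_powr (bilinear_frac_int \<alpha> f g x) q \<le> (SUP N. enn_powr (ennreal (?c * (\<Psi> k m N x + G))) q)"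
        using q bilinear_le_SUP[OF True] by (intro enn_powr_le_SUP) (auto simp: G_def)
      then show ?thesis
        using True G Psi_nonneg by (simp add: enn_powr_ennreal R_def)
    qed simp
  qed
  also have "\<dots> = (SUP N. \<integral>\<^sup>+ x. ennreal (R N x) * indicator ?D x \<partial>lborel)"
  proof (rule nn_integral_monotone_convergence_SUP)
    show "incseq (\<lambda>N x. ennreal (R N x) * indicator ?D x)"
      unfolding R_def incseq_def le_fun_def using q G Psi_nonneg incseqD[OF Psi_incseq]
      by (auto intro!: mult_right_mono ennreal_leI powr_mono2)
  qed simp
  also have "\<dots> \<le> ennreal (total_const * ?V powr (1 - q / p))"
    by (intro SUP_least R_int)
  finally show ?thesis .
qed

end

section \<open>Morrey norms\<close>

lemma AE_lborel_reflect:
  fixes x :: "'a::euclidean_space"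
  assumes "AE z in lborel. P z"
  shows "AE y in lborel. P (x - y)"
proof -
  have "AE z in distr lborel borel (\<lambda>y. x - y). P z"
    using assms by (simp only: lborel_distr_reflect)
  from AE_distrD[OF _ this] show ?thesis by simp
qed

lemma AE_lborel_translate:
  fixes x :: "'a::euclidean_space"
  assumes "AE z in lborel. P z"
  shows "AE y in lborel. P (x + y)"
proof -
  have "AE z in distr lborel borel (\<lambda>y. x + y). P z"
    using assms by (simp only: lborel_distr_plus)
  from AE_distrD[OF _ this] show ?thesis by simp
qed

text \<open>Reflection and translation preserve null sets, so equality holds at every
  \<open>x\<close>. This permits replacing Lebesgue measurable functions by Borel ones.\<close>

lemma bilinear_frac_int_cong_AE:
  assumes "AE z in lborel. f z = f' z" "AE z in lborel. g z = g' z"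
  shows "bilinear_frac_int \<alpha> f g = bilinear_frac_int \<alpha> f' g'"
proof
  fix x
  show "bilinear_frac_int \<alpha> f g x = bilinear_frac_int \<alpha> f' g' x"
    unfolding bilinear_frac_int_def nn_integral_completion
    using AE_lborel_reflect[OF assms(1), of x] AE_lborel_translate[OF assms(2), of x]
    by (intro nn_integral_cong_AE) auto
qed

lemma bilinear_frac_int_measurable:
  assumes [measurable]: "f \<in> borel_measurable borel" "g \<in> borel_measurable borel"
  shows "bilinear_frac_int \<alpha> f g \<in> borel_measurable borel"
  unfolding bilinear_frac_int_def nn_integral_completion by measurable

lemma bilinear_frac_int_scale:
  assumes [measurable]: "f \<in> borel_measurable borel" "g \<in> borel_measurable borel" and "0 < a" "0 < d"
  shows "bilinear_frac_int \<alpha> f g x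
    = ennreal (a * d) * bilinear_frac_int \<alpha> (\<lambda>x. f x / a) (\<lambda>x. g x / d) x"
  unfolding bilinear_frac_int_def nn_integral_completion using assms(3,4)
  by (subst nn_integral_cmult [symmetric]) (auto intro!: nn_integral_cong simp flip: ennreal_mult')

lemma measurable_enn_powr [measurable]:
  assumes [measurable]: "h \<in> borel_measurable M"
  shows "(\<lambda>x. enn_powr (h x) r) \<in> borel_measurable M"
  unfolding enn_powr_def by measurable

definition morrey_term :: "real \<Rightarrow> real \<Rightarrow> (real^'n::finite \<Rightarrow> ennreal) \<Rightarrow> int \<Rightarrow> ('n \<Rightarrow> int) \<Rightarrow> ennreal" where
  "morrey_term p q h k m = ennreal (cube_vol k m powr (1 / p)) * enn_powr (ennreal (1 / cube_vol k m)
     * (\<integral>\<^sup>+ x\<in>dyadic_cube k m. enn_powr (h x) q \<partial>lborel)) (1 / q)"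

lemma morrey_norm_eq:
  fixes h :: "real^'n::finite \<Rightarrow> ennreal"
  shows "morrey_norm p q h = (SUP (k, m). morrey_term p q h k m)"
proof -
  have cubes: "(dyadic_cubes :: (real^'n) set set) = range (\<lambda>(k, m). dyadic_cube k m)"
    by (auto simp: dyadic_cubes_def)
  show ?thesis
    unfolding morrey_norm_def morrey_term_def cubes image_image
    by (simp add: case_prod_beta measure_lebesgue_dyadic_cube nn_integral_completion)
qed

lemma morrey_norm_cong_AE:
  assumes "AE z in lborel. f z = f' z"
  shows "morrey_norm p q f = morrey_norm p q f'"
proof -
  have "(\<integral>\<^sup>+ x\<in>D. enn_powr (f x) q \<partial>lborel) = (\<integral>\<^sup>+ x\<in>D. enn_powr (f' x) q \<partial>lborel)" for D
    using assms by (intro nn_integral_cong_AE) auto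
  then show ?thesis unfolding morrey_norm_eq morrey_term_def by simp
qed

lemma cube_integral_le_morrey:
  assumes q: "0 < q" and a: "0 \<le> a" and le: "morrey_norm p q h \<le> ennreal a"
  shows "(\<integral>\<^sup>+ x\<in>dyadic_cube k m. enn_powr (h x) q \<partial>lborel) \<le> ennreal (a powr q * cube_vol k m powr (1 - q / p))"
proof -
  let ?V = "cube_vol k m"
  define T where "T = (\<integral>\<^sup>+ x\<in>dyadic_cube k m. enn_powr (h x) q \<partial>lborel)"
  have "morrey_term p q h k m \<le> morrey_norm p q h"
    unfolding morrey_norm_eq by (rule SUP_upper2[of "(k, m)"]) auto
  with le have le': "ennreal (?V powr (1 / p)) * enn_powr (ennreal (1 / ?V) * T) (1 / q) \<le> ennreal a"
    by (auto simp: morrey_term_def T_def)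
  show ?thesis
  proof (cases T)
    case (real t)
    have "ennreal (?V powr (1 / p) * (t / ?V) powr (1 / q)) \<le> ennreal a"
      using le' real by (simp add: enn_powr_ennreal less_imp_le flip: ennreal_mult)
    then have le'': "?V powr (1 / p) * (t / ?V) powr (1 / q) \<le> a" using a by simp
    then have "(?V powr (1 / p) * (t / ?V) powr (1 / q)) powr q \<le> a powr q"
      using q by (intro powr_mono2) auto
    then have "?V powr (q / p) * (t / ?V) \<le> a powr q"
      using q real by (simp add: powr_mult powr_powr less_imp_le)
    then have "?V powr (q / p) * (t / ?V) * ?V powr (1 - q / p) \<le> a powr q * ?V powr (1 - q / p)"
      by (intro mult_right_mono) auto
    moreover have "?V powr (q / p) * (t / ?V) * ?V powr (1 - q / p) = t"
      by (simp add: powr_diff)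
    ultimately show ?thesis using real by (simp add: T_def ennreal_leI)
  next
    case top
    moreover have "ennreal (1 / ?V) \<noteq> 0"
      using cube_vol_pos[of k m] by (simp add: ennreal_eq_0_iff not_le)
    ultimately show ?thesis using le' by (simp add: ennreal_mult_top top_unique)
  qed
qed

lemma morrey_norm_le:
  fixes h :: "real^'n::finite \<Rightarrow> ennreal"
  assumes q: "0 < q" and C: "0 \<le> C"
    and le: "\<And>k m. (\<integral>\<^sup>+ x\<in>dyadic_cube k m. enn_powr (h x) q \<partial>lborel) \<le> ennreal (C powr q * cube_vol k m powr (1 - q / p))"
  shows "morrey_norm p q h \<le> ennreal C"
  unfolding morrey_norm_eq
proof (safe intro!: SUP_least)
  fix k and m :: "'n \<Rightarrow> int"
  let ?V = "cube_vol k m"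
  have "morrey_term p q h k m \<le> ennreal (?V powr (1 / p)) * enn_powr (ennreal (1 / ?V) * ennreal (C powr q * ?V powr (1 - q / p))) (1 / q)"
    unfolding morrey_term_def using q by (intro mult_left_mono enn_powr_mono le) auto
  also have "\<dots> = ennreal (?V powr (1 / p) * (1 / ?V * (C powr q * ?V powr (1 - q / p))) powr (1 / q))"
    by (simp add: enn_powr_ennreal less_imp_le flip: ennreal_mult)
  also have "1 / ?V * (C powr q * ?V powr (1 - q / p)) = C powr q * ?V powr (- q / p)"
    by (simp add: powr_diff powr_minus_divide)
  also have "(C powr q * ?V powr (- q / p)) powr (1 / q) = C * ?V powr (- (1 / p))"
    using q C by (simp add: powr_mult powr_powr)
  also have "?V powr (1 / p) * (C * ?V powr (- (1 / p))) = C"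
    by (simp add: powr_minus_divide)
  finally show "morrey_term p q h k m \<le> ennreal C" .
qed

text \<open>A zero norm would force \<open>f\<close> to vanish almost everywhere on the unit cube.
  Positivity is needed to divide by the norms and to handle infinite ones.\<close>

lemma morrey_norm_pos:
  fixes f :: "real^'n::finite \<Rightarrow> real"
  assumes q: "0 < q" and [measurable]: "f \<in> borel_measurable borel" and pos: "AE x in lborel. 0 < f x"
  shows "0 < morrey_norm p q (\<lambda>x. ennreal (f x))"
proof (rule ccontr)
  define D :: "(real^'n) set" where "D = dyadic_cube 0 (\<lambda>_. 0)"
  have [measurable]: "D \<in> sets borel" by (simp add: D_def)
  assume "\<not> 0 < morrey_norm p q (\<lambda>x. ennreal (f x))"
  then have "morrey_norm p q (\<lambda>x. ennreal (f x)) \<le> ennreal 0" by simp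
  from cube_integral_le_morrey[OF q _ this, of 0 "\<lambda>_. 0"]
  have "(\<integral>\<^sup>+ x\<in>D. enn_powr (ennreal (f x)) q \<partial>lborel) = 0"
    using q by (simp add: D_def)
  then have "AE x in lborel. enn_powr (ennreal (f x)) q * indicator D x = 0"
    by (subst (asm) nn_integral_0_iff_AE) auto
  with pos have "AE x in lborel. x \<notin> D"
    by eventually_elim (auto simp: enn_powr_ennreal indicator_def split: if_splits)
  then have "emeasure lborel D = 0"
    by (subst (asm) AE_iff_measurable[OF _ refl]) (auto simp: space_borel)
  then show False
    using cube_vol_pos[of 0 "\<lambda>_ :: 'n. 0"] by (simp add: D_def emeasure_dyadic_cube)
qed

lemma morrey_scaled:
  fixes f :: "real^'n::finite \<Rightarrow> real"
  assumes q: "0 < q" and [measurable]: "f \<in> borel_measurable borel" and f: "\<And>x. 0 \<le> f x"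
    and a: "0 < a" and norm: "morrey_norm p q (\<lambda>x. ennreal (f x)) \<le> ennreal a"
  shows "locally_integrable (\<lambda>x. (f x / a) powr q)"
    and "cube_int (\<lambda>x. (f x / a) powr q) k m \<le> cube_vol k m powr (1 - q / p)"
proof -
  have le: "(\<integral>\<^sup>+ x. ennreal (indicator (dyadic_cube k m) x * f x powr q) \<partial>lborel)
      \<le> ennreal (a powr q * cube_vol k m powr (1 - q / p))" for k m
  proof -
    have "(\<integral>\<^sup>+ x. ennreal (indicator (dyadic_cube k m) x * f x powr q) \<partial>lborel)
        = (\<integral>\<^sup>+ x\<in>dyadic_cube k m. enn_powr (ennreal (f x)) q \<partial>lborel)"
      using f by (intro nn_integral_cong) (auto simp: enn_powr_ennreal indicator_def)
    then show ?thesis using cube_integral_le_morrey[OF q _ norm, of k m] a by simp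
  qed
  have int: "integrable lborel (\<lambda>x. indicator (dyadic_cube k m) x * f x powr q)" for k m
    using le[of k m] by (intro integrableI_nonneg) (auto simp: le_less_trans[OF _ ennreal_less_top])
  have scale: "indicator D x * (f x / a) powr q = (indicator D x * f x powr q) / a powr q" for D x
    using a f by (simp add: powr_divide)
  show "locally_integrable (\<lambda>x. (f x / a) powr q)"
    unfolding locally_integrable_def scale using int by auto
  have "ennreal (cube_int (\<lambda>x. f x powr q) k m) = (\<integral>\<^sup>+ x. ennreal (indicator (dyadic_cube k m) x * f x powr q) \<partial>lborel)"
    unfolding cube_int_def by (intro nn_integral_eq_integral [symmetric] int) auto
  with le[of k m] have "ennreal (cube_int (\<lambda>x. f x powr q) k m) \<le> ennreal (a powr q * cube_vol k m powr (1 - q / p))"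
    by simp
  then have "cube_int (\<lambda>x. f x powr q) k m \<le> a powr q * cube_vol k m powr (1 - q / p)"
    by (subst (asm) ennreal_le_iff) auto
  moreover have "cube_int (\<lambda>x. (f x / a) powr q) k m = cube_int (\<lambda>x. f x powr q) k m / a powr q"
    unfolding cube_int_def scale by simp
  ultimately show "cube_int (\<lambda>x. (f x / a) powr q) k m \<le> cube_vol k m powr (1 - q / p)"
    using a by (simp add: pos_divide_le_eq mult.commute)
qed

text \<open>Cutting a Borel version at 0 makes it nonnegative everywhere; strict positivity survives
  almost everywhere, as \<open>morrey_norm_pos\<close> requires.\<close>

lemma borel_representative:
  fixes f :: "real^'n::finite \<Rightarrow> real"
  assumes "f \<in> borel_measurable lebesgue" "\<And>x. 0 < f x"
  obtains f' where "f' \<in> borel_measurable borel" "\<And>x. 0 \<le> f' x" "AE x in lborel. f x = f' x"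
proof -
  obtain h where [measurable]: "h \<in> borel_measurable lborel" and h: "AE x in lborel. f x = h x"
    using completion_ex_borel_measurable_real[OF assms(1)] by auto
  show ?thesis
  proof
    show "(\<lambda>x. max 0 (h x)) \<in> borel_measurable borel" by measurable
    show "AE x in lborel. f x = max 0 (h x)"
      using h by eventually_elim (metis assms(2) max.absorb2 less_imp_le)
  qed simp
qed

text \<open>By homogeneity \<open>f / a\<close> and \<open>g / d\<close> form a
  \<open>normalized_pair\<close>, whose \<open>total_const\<close> depends on the dimension and the
  exponents but on neither function.\<close>

lemma morrey_bilinear_le:
  fixes f g :: "real^'n::finite \<Rightarrow> real"
  assumes alpha: "0 < \<alpha>" "\<alpha> < real CARD('n)" and b: "1 < b" and c: "1 < c" "1 / b + 1 / c = 1"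
    and p: "0 < p" and q: "c < q"
    and borel [measurable]: "f \<in> borel_measurable borel" "g \<in> borel_measurable borel"
    and nonneg: "\<And>x. 0 \<le> f x" "\<And>x. 0 \<le> g x"
    and a: "0 < a" "morrey_norm (real CARD('n) / \<alpha>) b (\<lambda>x. ennreal (f x)) \<le> ennreal a"
    and d: "0 < d" "morrey_norm p q (\<lambda>x. ennreal (g x)) \<le> ennreal d"
  shows "morrey_norm p q (bilinear_frac_int \<alpha> f g)
    \<le> ennreal (normalized_pair.total_const TYPE('n) \<alpha> b c p q powr (1 / q) * (a * d))"
proof -
  let ?B = "bilinear_frac_int \<alpha> (\<lambda>x. f x / a) (\<lambda>x. g x / d)"
  let ?C = "normalized_pair.total_const TYPE('n) \<alpha> b c p q"
  interpret normalized_pair \<alpha> b c p q "\<lambda>x. f x / a" "\<lambda>x. g x / d"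
  proof unfold_locales
    show "locally_integrable (\<lambda>x. (f x / a) powr b)"
      using b by (intro morrey_scaled[OF _ borel(1) nonneg(1) a]) auto
    show "locally_integrable (\<lambda>x. (g x / d) powr q)"
      using c q by (intro morrey_scaled[OF _ borel(2) nonneg(2) d]) auto
    show "cube_int (\<lambda>x. (g x / d) powr q) k m \<le> cube_vol k m powr (1 - q / p)" for k m
      using c q by (intro morrey_scaled[OF _ borel(2) nonneg(2) d]) auto
    fix k and m :: "'n \<Rightarrow> int"
    have "cube_int (\<lambda>x. (f x / a) powr b) k m \<le> cube_vol k m powr (1 - b / (real CARD('n) / \<alpha>))"
      using b by (intro morrey_scaled[OF _ borel(1) nonneg(1) a]) auto
    also have "\<dots> = 2 powr (- real_of_int k * \<alpha> * b) * cube_vol k m"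
      by (simp add: cube_vol_def powr_powr powr_add [symmetric] right_diff_distrib mult_ac)
    finally show "cube_int (\<lambda>x. (f x / a) powr b) k m \<le> 2 powr (- real_of_int k * \<alpha> * b) * cube_vol k m" .
  qed (use assms in auto)
  have q0: "0 < q" using c q by simp
  have [measurable]: "?B \<in> borel_measurable borel"
    by (intro bilinear_frac_int_measurable) auto
  have "(\<integral>\<^sup>+ x\<in>dyadic_cube k m. enn_powr (bilinear_frac_int \<alpha> f g x) q \<partial>lborel)
      \<le> ennreal ((?C powr (1 / q) * (a * d)) powr q * cube_vol k m powr (1 - q / p))" for k m
  proof -
    have "enn_powr (bilinear_frac_int \<alpha> f g x) q = ennreal ((a * d) powr q) * enn_powr (?B x) q" for x
      using a d by (simp add: bilinear_frac_int_scale[OF borel a(1) d(1)] enn_powr_cmult)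
    then have "(\<integral>\<^sup>+ x\<in>dyadic_cube k m. enn_powr (bilinear_frac_int \<alpha> f g x) q \<partial>lborel)
        = ennreal ((a * d) powr q) * (\<integral>\<^sup>+ x\<in>dyadic_cube k m. enn_powr (?B x) q \<partial>lborel)"
      by (simp add: mult.assoc nn_integral_cmult)
    also have "\<dots> \<le> ennreal ((a * d) powr q) * ennreal (?C * cube_vol k m powr (1 - q / p))"
      by (intro mult_left_mono bilinear_cube_integral) simp
    also have "\<dots> = ennreal ((?C powr (1 / q) * (a * d)) powr q * cube_vol k m powr (1 - q / p))"
      using q0 a(1) d(1) total_const_nonneg
      by (simp add: powr_mult powr_powr mult_ac flip: ennreal_mult)
    finally show ?thesis .
  qed
  then show ?thesis
    using a(1) d(1) by (intro morrey_norm_le q0) auto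
qed

theorem theorem1p3:
  fixes \<alpha> p1 q1 p2 q2 :: real
  assumes "0 < \<alpha>" and "\<alpha> < real CARD('n::finite)"
    and "1 < q1" and "q1 \<le> p1" and "p1 = real CARD('n) / \<alpha>"
    and "1 < q2" and "q2 \<le> p2" and "p2 < q2 * real CARD('n) / \<alpha>"
    and "1 / q1 + 1 / q2 < 1"
  shows "\<exists>C>0. \<forall>(f :: real^'n \<Rightarrow> real) (g :: real^'n \<Rightarrow> real).
           f \<in> borel_measurable lebesgue \<longrightarrow> g \<in> borel_measurable lebesgue \<longrightarrow>
           (\<forall>x. 0 < f x) \<longrightarrow> (\<forall>x. 0 < g x) \<longrightarrow>
           morrey_norm p2 q2 (bilinear_frac_int \<alpha> f g)
             \<le> ennreal C * morrey_norm p1 q1 (\<lambda>x. ennreal (f x)) * morrey_norm p2 q2 (\<lambda>x. ennreal (g x))"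
proof -
  define c where "c = q1 / (q1 - 1)"
  have c: "1 < c" "1 / q1 + 1 / c = 1" using assms(3) by (auto simp: c_def field_simps)
  \<comment> \<open>The hypothesis on \<open>q1\<close> and \<open>q2\<close> enters here, in the
    form \<open>c < q2\<close>.\<close>
  have "1 / q2 < 1 / c" using c(2) assms(9) by linarith
  then have "c < q2" using c(1) assms(6) by (simp add: field_simps)
  \<comment> \<open>The summand 1 guarantees \<open>C > 0\<close>.\<close>
  define C where "C = normalized_pair.total_const TYPE('n) \<alpha> q1 c p2 q2 powr (1 / q2) + 1"
  have C: "0 < C" by (simp add: C_def add_nonneg_pos)
  show ?thesis
  proof (intro exI[of _ C] conjI C allI impI)
    fix f g :: "real^'n \<Rightarrow> real"
    assume f: "f \<in> borel_measurable lebesgue" "\<forall>x. 0 < f x" and g: "g \<in> borel_measurable lebesgue" "\<forall>x. 0 < g x"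
    let ?M1 = "morrey_norm p1 q1 (\<lambda>x. ennreal (f x))" and ?M2 = "morrey_norm p2 q2 (\<lambda>x. ennreal (g x))"
    obtain f' where f': "f' \<in> borel_measurable borel" "\<And>x. 0 \<le> f' x" "AE x in lborel. f x = f' x"
      using borel_representative[of f] f by auto
    obtain g' where g': "g' \<in> borel_measurable borel" "\<And>x. 0 \<le> g' x" "AE x in lborel. g x = g' x"
      using borel_representative[of g] g by auto
    have M1: "?M1 = morrey_norm p1 q1 (\<lambda>x. ennreal (f' x))"
      by (rule morrey_norm_cong_AE) (use f'(3) in auto)
    have M2: "?M2 = morrey_norm p2 q2 (\<lambda>x. ennreal (g' x))"
      by (rule morrey_norm_cong_AE) (use g'(3) in auto)
    have "AE x in lborel. 0 < f' x"
      using f'(3) by eventually_elim (metis f(2))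
    then have M1_pos: "0 < ?M1"
      unfolding M1 using assms(3) f'(1) by (intro morrey_norm_pos) auto
    have "AE x in lborel. 0 < g' x"
      using g'(3) by eventually_elim (metis g(2))
    then have M2_pos: "0 < ?M2"
      unfolding M2 using assms(6) g'(1) by (intro morrey_norm_pos) auto
    show "morrey_norm p2 q2 (bilinear_frac_int \<alpha> f g) \<le> ennreal C * ?M1 * ?M2"
    \<comment> \<open>As \<open>0 * top = 0\<close> for \<open>ennreal\<close>, positivity of both
      norms is what makes the right side infinite in the first case.\<close>
    proof (cases "?M1 = top \<or> ?M2 = top")
      case True
      then have "ennreal C * ?M1 * ?M2 = top"
        using C M1_pos M2_pos by (auto simp: ennreal_mult_eq_top_iff ennreal_eq_0_iff)
      then show ?thesis by simp
    next
      case False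
      then obtain a d where ad: "0 \<le> a" "?M1 = ennreal a" "0 \<le> d" "?M2 = ennreal d"
        by (cases ?M1; cases ?M2) auto
      then have pos: "0 < a" "0 < d" using M1_pos M2_pos by auto
      have "morrey_norm p2 q2 (bilinear_frac_int \<alpha> f g) = morrey_norm p2 q2 (bilinear_frac_int \<alpha> f' g')"
        by (simp only: bilinear_frac_int_cong_AE[OF f'(3) g'(3)])
      also have "\<dots> \<le> ennreal (normalized_pair.total_const TYPE('n) \<alpha> q1 c p2 q2 powr (1 / q2) * (a * d))"
        by (rule morrey_bilinear_le)
           (use assms c \<open>c < q2\<close> f' g' pos ad M1 M2 in auto)
      also have "\<dots> \<le> ennreal (C * (a * d))"
        using pos by (intro ennreal_leI mult_right_mono) (auto simp: C_def)
      also have "\<dots> = ennreal C * ?M1 * ?M2"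
        using ad C by (simp add: ennreal_mult mult.assoc)
      finally show ?thesis .
    qed
  qed
qed

end
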